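(* Let $d\ge 1$. Let $u\ge 0$ be a bounded continuous function on $[0,\infty)$ with $\sup_{0\le x<\infty}xu(x)<\infty$, such that $u$ is nonincreasing and $s\mapsto su(s)$ is strictly increasing on $[0,\infty)$. Let $a_0:=\sup_{s>0}su(s)=\lim_{s\to\infty}su(s)$ and suppose $a_0>d$. Let $Q$ be a Borel probability measure on $\mathbb{R}^d$. Then: (a) If $Q\notin\mathcal{U}_{d,a_0}$, then $Qh$ has no critical points on $\mathcal{P}_d$. (b) If $Q\in\mathcal{U}_{d,a_0}$, then $Qh$ attains its minimum over $\mathcal{P}_d$ at a unique $B=B(Q)\in\mathcal{P}_d$ and has no other critical points.
   Context: $\mathcal{P}_d$ is the set of symmetric strictly positive definite real $d\times d$ matrices, an open subset of the vector space $\mathcal{S}_d$ of symmetric real $d\times d$ matrices. Vectors are columns and $'$ denotes transpose. The function $\rho:[0,\infty)\to[0,\infty)$ is continuous with continuous derivative $\rho'(s)=u(s)/2$ for $s\ge 0$ (one-sided derivative at $0$). For $A\in\mathcal{P}_d$, $$Qh(A):=\tfrac12\log\det A+\int \big(\rho(y'A^{-1}y)-\rho(y'y)\big)\,dQ(y),$$ which is well defined, finite and $C^1$ in $A\in\mathcal{P}_d$. A critical point of $Qh$ is a point of $\mathcal{P}_d$ where the gradient of $Qh$ is $0$. For $a>0$, $\mathcal{U}_{d,a}$ is the set of all Borel probability measures $Q$ on $\mathbb{R}^d$ such that for every linear subspace $H$ of $\mathbb{R}^d$ of dimension $q$ with $0\le q\le d-1$, $Q(H)<1-(d-q)/a$.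 *)

theory Defs
  imports "HOL-Probability.Probability"
begin

definition sym_mats :: "(real^'n^'n) set" where
  "sym_mats = {A. transpose A = A}"

definition pd_mats :: "(real^'n^'n) set" where
  "pd_mats = {A \<in> sym_mats. \<forall>x. x \<noteq> 0 \<longrightarrow> 0 < x \<bullet> (A *v x)}"

(* If rho' = u/2 on [0,\<infinity>), where s * u s is bounded, then for A in pd_mats the integrand is
   bounded and Borel measurable, so the Bochner integral against a Borel probability measure
   is not the default value 0 of the integral of a non-integrable function. *)
definition Qh :: "(real \<Rightarrow> real) \<Rightarrow> (real^'n) measure \<Rightarrow> real^'n^'n \<Rightarrow> real" where
  "Qh \<rho> Q A = ln (det A) / 2 + (LINT y|Q. \<rho> (y \<bullet> (matrix_inv A *v y)) - \<rho> (y \<bullet> y))"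

(* The gradient of f : pd_mats -> R in the vector space sym_mats, for the inner product
   trace (transpose G ** H), which is the library's G \<bullet> H on real^'n^'n.  Since pd_mats is open
   in sym_mats, the derivative within pd_mats is the derivative in sym_mats, and
   G \<in> sym_mats makes G unique. *)
definition has_sym_gradient :: "(real^'n^'n \<Rightarrow> real) \<Rightarrow> real^'n^'n \<Rightarrow> real^'n^'n \<Rightarrow> bool" where
  "has_sym_gradient f G A \<longleftrightarrow>
     G \<in> sym_mats \<and> (f has_derivative (\<lambda>H. G \<bullet> H)) (at A within pd_mats)"

definition critical_points :: "(real^'n^'n \<Rightarrow> real) \<Rightarrow> (real^'n^'n) set" where
  "critical_points f = {A \<in> pd_mats. has_sym_gradient f 0 A}"

definition borel_prob_measures :: "(real^'n) measure set" where
  "borel_prob_measures = {Q. prob_space Q \<and> sets Q = sets borel}"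

definition U_class :: "real \<Rightarrow> (real^'n) measure set" where
  "U_class a = {Q \<in> borel_prob_measures.
     \<forall>H. subspace H \<and> dim H < CARD('n) \<longrightarrow>
       measure Q H < 1 - (real CARD('n) - real (dim H)) / a}"

(* The supremum of s * u s over s > 0 is also its limit at infinity. *)
lemma mono_tendsto_SUP_at_top:
  fixes u :: "real \<Rightarrow> real"
  assumes bdd: "bdd_above ((\<lambda>s. s * u s) ` {0..})"
    and mono: "strict_mono_on {0..} (\<lambda>s. s * u s)"
  shows "((\<lambda>s. s * u s) \<longlongrightarrow> (SUP s\<in>{0<..}. s * u s)) at_top"
proof (rule order_tendstoI)
  have bdd': "bdd_above ((\<lambda>s. s * u s) ` {0<..})"
    by (rule bdd_above_mono[OF bdd]) auto
  {
    fix a assume "a < (SUP s\<in>{0<..}. s * u s)"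
    then obtain t where t: "t > 0" "a < t * u t"
      using less_cSUP_iff[OF _ bdd', of a] by auto
    have "a < s * u s" if "s \<ge> t" for s
    proof -
      have "t * u t \<le> s * u s"
        using strict_mono_on_leD[OF mono, of t s] t that by simp
      then show ?thesis using t by simp
    qed
    then show "\<forall>\<^sub>F s in at_top. a < s * u s"
      by (auto simp: eventually_at_top_linorder)
  next
    fix a assume a: "(SUP s\<in>{0<..}. s * u s) < a"
    have "s * u s < a" if "s > 0" for s
      using cSUP_upper[OF _ bdd', of s] that a by simp
    then show "\<forall>\<^sub>F s in at_top. s * u s < a"
      by (rule eventually_mono[OF eventually_gt_at_top[of 0]])
  }
qed

end

theory Submission
  imports Defs
begin

text \<open>
  Let \<open>a\<close> be the supremum of \<open>s u(s)\<close>. Every two points of the cone of positive definite matrices can be diagonalized simultaneously: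
  they are \<open>F F'\<close> and \<open>geo F l = F diag(exp l) F'\<close> for an invertible \<open>F\<close> and a vector \<open>l\<close>. The
  curve \<open>t \<mapsto> geo F (t l)\<close> joins them, and \<open>Qh\<close> is convex along such curves. Indeed, with
  \<open>z = F\<^sup>-\<^sup>1 y\<close> the quadratic form of the inverse of \<open>geo F (t l)\<close> at \<open>y\<close> is
  \<open>\<Sum>i. exp (- t l\<^sub>i) z\<^sub>i\<^sup>2\<close>, whose logarithm is convex in \<open>t\<close>, while \<open>\<rho> (exp x)\<close> is convex and increasing in
  \<open>x\<close>, because its derivative is \<open>s u(s) / 2\<close> at \<open>s = exp x\<close>.

  Convexity, differentiability and continuity are all used in the form of a two-sided estimate
  that holds for every \<open>y\<close> and can therefore be integrated:
  \<^item> \<open>slope F l \<le> Qh (geo F l) - Qh (F F')\<close>, and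
  \<^item> \<open>Qh (geo F l) - Qh (F F') \<le> slope F l + O(|l|\<^sup>2)\<close> for \<open>|l| \<le> 1\<close>,

  where \<open>slope F l\<close> is linear in \<open>l\<close> (\<open>Qh_above_slope\<close>, \<open>Qh_below_slope_quadratic\<close>). Since
  \<open>|l|\<close> is bounded by a multiple of \<open>|geo F l - F F'|\<close> near \<open>F F'\<close>, uniformly over all \<open>F\<close> with the
  same \<open>F F'\<close>, the estimate says that a point
  \<open>F F'\<close> is critical iff all its slopes vanish iff it is a global minimizer. If \<open>Q\<close> charges the
  complement of every proper subspace, then the lower bound is strict for \<open>l \<noteq> 0\<close>, so that a
  critical point is unique.

  At a critical point \<open>F F'\<close>, take the columns of \<open>F\<close> adapted to a subspace \<open>H\<close> of dimension \<open>q < d\<close>,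
  and let \<open>l\<close> be the indicator of the \<open>d - q\<close> coordinates that vanish on \<open>H\<close>. Then \<open>slope F l = 0\<close>
  writes \<open>d - q\<close> as the integral of a function that is \<open>0\<close> on \<open>H\<close> and less than \<open>a\<close> elsewhere, which
  gives \<open>d - q < a (1 - Q(H))\<close>. This is part (a) (\<open>U_class_if_critical\<close>).

  For existence, along a ray \<open>geo F (n l)\<close> the quotients of \<open>Qh\<close> by \<open>n\<close> tend to
  \<open>1/2 (\<Sum>i. l\<^sub>i + a \<integral> max {(l\<^sub>i)\<^sup>- | z\<^sub>i \<noteq> 0} dQ)\<close>, where \<open>(l\<^sub>i)\<^sup>-\<close> is the negative part. Slicing the
  maximum into levels turns it into a positive combination of the
  inequalities \<open>d - q < a (1 - Q(H))\<close> for coordinate subspaces \<open>H\<close>, so the limit is positive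
  if some \<open>l\<^sub>i\<close> is negative; otherwise it is positive because \<open>\<Sum>i. l\<^sub>i > 0\<close>, for \<open>l \<noteq> 0\<close>
  (\<open>Qh_exceeds_along_ray\<close>). By convexity and by compactness of the set of orthogonal matrices
  times the unit sphere, \<open>Qh\<close> is positive outside a compact set that contains the identity matrix,
  where \<open>Qh\<close> is \<open>0\<close>. Hence a minimizer exists
  (\<open>minimizer_exists\<close>).
\<close>

section \<open>Spectral decomposition of symmetric matrices\<close>

lemma symmetric_matrix_inner:
  fixes A :: "real^'n^'n"
  assumes "transpose A = A"
  shows "(A *v x) \<bullet> y = x \<bullet> (A *v y)"
  using assms by (metis dot_lmul_matrix vector_transpose_matrix)

text \<open>The unit vector at which the Rayleigh quotient is largest is an eigenvector: the first variation of
the quotient vanishes in every orthogonal direction, so \<open>f v\<close> is parallel to \<open>v\<close>.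
The subspace \<open>S\<close> is there for the induction that splits off one eigenvector at a time.\<close>

lemma selfadjoint_eigenvector_exists:
  fixes f :: "'a::euclidean_space \<Rightarrow> 'a"
  assumes lin: "linear f" and sa: "\<And>x y. f x \<bullet> y = x \<bullet> f y"
    and S: "subspace S" "f ` S \<subseteq> S" and nz: "S \<noteq> {0}"
  obtains v c where "v \<in> S" "norm v = 1" "f v = c *\<^sub>R v"
proof -
  obtain w where w: "w \<in> S" "w \<noteq> 0" using nz S(1) subspace_0 by blast
  define K where "K = S \<inter> sphere 0 1"
  have "compact K" unfolding K_def
    using closed_subspace[OF S(1)] by (simp add: closed_Int_compact)
  moreover have "(1 / norm w) *\<^sub>R w \<in> K" using w S(1) by (auto simp: K_def subspace_scale)
  hence "K \<noteq> {}" by blast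
  moreover have "continuous_on K (\<lambda>x. x \<bullet> f x)"
    by (intro continuous_intros linear_continuous_on_compose[OF continuous_on_id lin])
  ultimately obtain v where v: "v \<in> K" and max: "\<And>y. y \<in> K \<Longrightarrow> y \<bullet> f y \<le> v \<bullet> f v"
    using continuous_attains_sup[of K "\<lambda>x. x \<bullet> f x"] by auto
  have vS: "v \<in> S" and nv: "norm v = 1" using v by (auto simp: K_def)
  define m where "m = v \<bullet> f v"
  have ray: "y \<bullet> f y \<le> m * (norm y)\<^sup>2" if "y \<in> S" for y
  proof (cases "y = 0")
    case True then show ?thesis by (simp add: linear_0[OF lin])
  next
    case False
    have "(1 / norm y) *\<^sub>R y \<in> K" using that False S(1) by (auto simp: K_def subspace_scale)
    from max[OF this] have "(y \<bullet> f y) / (norm y)\<^sup>2 \<le> m"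
      by (simp add: linear_scale[OF lin] m_def power2_eq_square)
    then show ?thesis using False by (simp add: divide_le_eq)
  qed
  have orth: "f v \<bullet> w = 0" if "w \<in> S" "v \<bullet> w = 0" for w
  proof (rule ccontr)
    assume c: "f v \<bullet> w \<noteq> 0"
    define b where "b = f v \<bullet> w"
    define k where "k = m * (norm w)\<^sup>2 - w \<bullet> f w"
    have *: "2 * t * b \<le> t\<^sup>2 * k" for t :: real
    proof -
      have "v + t *\<^sub>R w \<in> S" using vS that S(1) by (simp add: subspace_add subspace_scale)
      from ray[OF this] have "(v + t *\<^sub>R w) \<bullet> f (v + t *\<^sub>R w) \<le> m * (norm (v + t *\<^sub>R w))\<^sup>2" .
      moreover have "(norm (v + t *\<^sub>R w))\<^sup>2 = 1 + t\<^sup>2 * (norm w)\<^sup>2"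
        using nv that(2)
        by (simp only: power2_norm_eq_inner inner_add_left inner_add_right)
           (simp add: inner_commute norm_eq_1 power2_eq_square)
      moreover have "(v + t *\<^sub>R w) \<bullet> f (v + t *\<^sub>R w) = m + 2 * t * b + t\<^sup>2 * (w \<bullet> f w)"
        using sa[of w v] sa[of v w]
        by (simp add: linear_add[OF lin] linear_scale[OF lin] inner_add_left inner_add_right
            m_def b_def power2_eq_square inner_commute algebra_simps)
      ultimately show ?thesis by (simp add: k_def algebra_simps)
    qed
    have b: "b \<noteq> 0" using c b_def by simp
    \<comment> \<open>A linear term cannot stay below a quadratic one near the origin; \<open>\<bar>k\<bar> + 1\<close> avoids a
       case distinction on the sign of \<open>k\<close>.\<close>
    define t where "t = b / (\<bar>k\<bar> + 1)"
    have "t\<^sup>2 * k \<le> t\<^sup>2 * (\<bar>k\<bar> + 1)" by (intro mult_left_mono) auto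
    also have "\<dots> = t * b" by (simp add: t_def power2_eq_square)
    finally have "t * b \<le> 0" using *[of t] by simp
    moreover have "t * b > 0" using b unfolding t_def
      by (simp add: zero_less_mult_iff zero_less_divide_iff) linarith
    ultimately show False by simp
  qed
  define w' where "w' = f v - m *\<^sub>R v"
  have w'S: "w' \<in> S" unfolding w'_def
    using S(2) vS by (intro subspace_diff[OF S(1)] subspace_scale[OF S(1)]) blast+
  have vw': "v \<bullet> w' = 0" using nv by (simp add: w'_def inner_diff_right m_def norm_eq_1)
  have "w' \<bullet> w' = f v \<bullet> w' - m * (v \<bullet> w')"
    by (simp add: w'_def inner_diff_left)
  hence "w' = 0" using orth[OF w'S vw'] vw' by simp
  hence "f v = m *\<^sub>R v" by (simp add: w'_def)
  then show thesis using that vS nv by blast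
qed

lemma selfadjoint_orthonormal_eigenbasis:
  fixes f :: "'a::euclidean_space \<Rightarrow> 'a"
  assumes lin: "linear f" and sa: "\<And>x y. f x \<bullet> y = x \<bullet> f y"
    and "subspace S" "f ` S \<subseteq> S"
  shows "\<exists>B \<subseteq> S. pairwise orthogonal B \<and> (\<forall>b\<in>B. norm b = 1) \<and> card B = dim S \<and>
           (\<forall>b\<in>B. \<exists>c. f b = c *\<^sub>R b)"
  using assms(3,4)
proof (induction "dim S" arbitrary: S)
  case 0
  then show ?case by (intro exI[of _ "{}"]) auto
next
  case (Suc n)
  from Suc.hyps(2) have "S \<noteq> {0}" by auto
  then obtain v c where v: "v \<in> S" "norm v = 1" "f v = c *\<^sub>R v"
    using selfadjoint_eigenvector_exists[OF lin sa Suc.prems] by blast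
  define T where "T = {y \<in> S. \<forall>x \<in> span {v}. orthogonal x y}"
  have "span {v} \<subseteq> S" using v(1) Suc.prems(1) by (simp add: span_minimal)
  hence "dim T + dim (span {v}) = dim S"
    unfolding T_def using dim_subspace_orthogonal_to_vectors Suc.prems(1) subspace_span by blast
  moreover have "dim (span {v}) = 1" using v(2) by (simp only: dim_span dim_singleton) auto
  ultimately have dT: "n = dim T" using Suc.hyps(2) by simp
  have T_alt: "T = {y \<in> S. v \<bullet> y = 0}"
    unfolding T_def by (auto simp: span_singleton orthogonal_def)
  have sT: "subspace T"
    using Suc.prems(1) unfolding T_alt subspace_def by (auto simp: inner_add_right)
  have fT: "f ` T \<subseteq> T"
    using Suc.prems(2) sa[of v, symmetric] v(3) unfolding T_alt by (auto simp: image_subset_iff)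
  from Suc.hyps(1)[OF dT sT fT] obtain B where B: "B \<subseteq> T" "pairwise orthogonal B"
    "\<forall>b\<in>B. norm b = 1" "card B = dim T" "\<forall>b\<in>B. \<exists>c. f b = c *\<^sub>R b" by blast
  have "v \<notin> B" using B(1) v(2) unfolding T_alt by auto
  moreover have "finite B" using B(2,3) pairwise_orthogonal_imp_finite by auto
  ultimately have "card (insert v B) = dim S" using B(4) dT Suc.hyps(2) by simp
  moreover have "pairwise orthogonal (insert v B)"
    using B(1,2) unfolding T_alt
    by (auto simp: pairwise_insert orthogonal_def inner_commute)
  ultimately show ?case using B v T_alt
    by (intro exI[of _ "insert v B"]) auto
qed

lemma orthogonal_matrix_of_orthonormal_set:
  fixes B :: "(real^'n) set"
  assumes "pairwise orthogonal B" "\<And>b. b \<in> B \<Longrightarrow> norm b = 1" "card B = CARD('n)"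
  obtains R :: "real^'n^'n" where "orthogonal_matrix R" "bij_betw (\<lambda>i. column i R) UNIV B"
proof -
  have "finite B" using assms(3) by (intro card_ge_0_finite) simp
  then obtain g :: "'n \<Rightarrow> real^'n" where g: "bij_betw g UNIV B"
    using finite_same_card_bij[of "UNIV :: 'n set" B] assms(3) by auto
  define R :: "real^'n^'n" where "R = (\<chi> i j. g j $ i)"
  have col: "column i R = g i" for i by (simp add: R_def column_def vec_eq_iff)
  have "orthogonal_matrix R"
    unfolding orthogonal_matrix_orthonormal_columns col
    using assms(1,2) g unfolding bij_betw_def inj_on_def pairwise_def by (metis UNIV_I image_eqI)
  then show thesis using that g by (simp add: col)
qed

definition diag_mat :: "real^'n \<Rightarrow> real^'n^'n" where
  "diag_mat v = (\<chi> i j. if i = j then v $ i else 0)"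

lemma diag_mat_vector: "diag_mat v *v x = (\<chi> i. v $ i * x $ i)"
  by (simp add: diag_mat_def matrix_vector_mult_def vec_eq_iff if_distrib[of "\<lambda>a. a * _"] cong: if_cong)

lemma det_diag_mat: "det (diag_mat v) = (\<Prod>i\<in>UNIV. v $ i)"
  by (subst det_diagonal) (simp_all add: diag_mat_def)

lemma transpose_diag_mat [simp]: "transpose (diag_mat v) = diag_mat v"
  by (auto simp: diag_mat_def transpose_def vec_eq_iff)

lemma diag_mat_mult: "diag_mat v ** diag_mat w = diag_mat (\<chi> i. v $ i * w $ i)"
  by (simp add: matrix_eq matrix_vector_mul_assoc[symmetric] diag_mat_vector mult.assoc)

lemma diag_mat_1: "diag_mat (\<chi> i. 1) = mat 1"
  by (simp add: diag_mat_def mat_def vec_eq_iff)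

lemma symmetric_matrix_diagonalization:
  fixes A :: "real^'n^'n"
  assumes "transpose A = A"
  obtains R :: "real^'n^'n" and l where "orthogonal_matrix R" "A = R ** diag_mat l ** transpose R"
proof -
  obtain B where B: "pairwise orthogonal B" "\<forall>b\<in>B. norm b = 1" "card B = dim (UNIV::(real^'n) set)"
      "\<forall>b\<in>B. \<exists>c. A *v b = c *\<^sub>R b"
    using selfadjoint_orthonormal_eigenbasis[of "(*v) A" UNIV] symmetric_matrix_inner[OF assms]
    by auto
  obtain R :: "real^'n^'n" where R: "orthogonal_matrix R" and bij: "bij_betw (\<lambda>i. column i R) UNIV B"
    using orthogonal_matrix_of_orthonormal_set[of B] B by auto
  have "\<forall>i. \<exists>c. A *v column i R = c *\<^sub>R column i R"
    using B(4) bij by (auto simp: bij_betw_def)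
  then obtain e where e: "\<And>i. A *v column i R = e i *\<^sub>R column i R" by metis
  define l where "l = (\<chi> i. e i)"
  have "(A ** R) $ i $ j = (R ** diag_mat l) $ i $ j" for i j
  proof -
    have "(A ** R) $ i $ j = (A *v column j R) $ i"
      by (simp add: matrix_matrix_mult_def matrix_vector_mult_def column_def)
    also have "\<dots> = (R ** diag_mat l) $ i $ j"
      by (simp only: e) (simp add: matrix_matrix_mult_def diag_mat_def l_def column_def if_distrib[of "\<lambda>a. _ * a"] cong: if_cong)
    finally show ?thesis .
  qed
  hence "A ** R = R ** diag_mat l" by (simp add: vec_eq_iff)
  hence "R ** diag_mat l ** transpose R = A ** (R ** transpose R)"
    by (simp add: matrix_mul_assoc)
  hence "A = R ** diag_mat l ** transpose R"
    using R by (simp add: orthogonal_matrix_def matrix_mul_rid)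
  then show thesis using that R by blast
qed

section \<open>Exponential coordinates on the positive definite matrices\<close>

text \<open>For invertible \<open>F\<close>, \<open>t \<mapsto> geo F (t l)\<close> is the geodesic through \<open>F F'\<close> of the affine-invariant
metric on the positive definite matrices.\<close>

definition geo :: "real^'n^'n \<Rightarrow> real^'n \<Rightarrow> real^'n^'n" where
  "geo F l = F ** diag_mat (\<chi> i. exp (l $ i)) ** transpose F"

lemma geo_0: "geo F 0 = F ** transpose F"
  by (simp add: geo_def diag_mat_1 matrix_mul_rid)

lemma geo_component: "geo F l $ i $ j = (\<Sum>k\<in>UNIV. F $ i $ k * exp (l $ k) * F $ j $ k)"
  by (simp add: geo_def matrix_matrix_mult_def diag_mat_def transpose_def
      if_distrib[of "\<lambda>a. _ * a"] cong: if_cong)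

text \<open>Every point of the curve is a base point of the same curve, so that a statement about the base point
\<open>F F'\<close> holds along the whole curve.\<close>

lemma geo_shift: "geo (F ** diag_mat (\<chi> i. exp (m $ i / 2))) l = geo F (m + l)"
proof -
  have "exp (m $ i / 2) * exp (l $ i) * exp (m $ i / 2) = exp ((m + l) $ i)" for i
    by (simp add: exp_add[symmetric])
  then show ?thesis
    by (simp add: geo_def matrix_transpose_mul matrix_mul_assoc[symmetric])
       (simp add: matrix_mul_assoc[of "diag_mat _"] diag_mat_mult mult.assoc[symmetric])
qed

lemma det_geo: "det (geo F l) = (det F)\<^sup>2 * exp (\<Sum>i\<in>UNIV. l $ i)"
  by (simp add: geo_def det_mul det_diag_mat power2_eq_square exp_sum)

lemma orthogonal_matrix_invertible: "orthogonal_matrix R \<Longrightarrow> invertible R"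
  unfolding orthogonal_matrix_def invertible_def by blast

lemma matrix_inv_cancel:
  assumes "invertible A"
  shows "A ** matrix_inv A = mat 1" "matrix_inv A ** A = mat 1"
  using someI_ex[OF assms[unfolded invertible_def]] unfolding matrix_inv_def by auto

lemma matrix_inv_unique:
  fixes A :: "real^'n^'n"
  assumes "A ** B = mat 1" shows "matrix_inv A = B"
proof -
  have "invertible A" using assms invertible_right_inverse by blast
  note inv = matrix_inv_cancel(2)[OF this]
  have "matrix_inv A = matrix_inv A ** (A ** B)" by (simp add: assms matrix_mul_rid)
  also have "\<dots> = B" by (simp add: matrix_mul_assoc inv matrix_mul_lid)
  finally show ?thesis .
qed

lemma matrix_inv_orthogonal: 
  fixes R :: "real^'n^'n"
  assumes "orthogonal_matrix R" shows "matrix_inv R = transpose R"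
  using assms by (intro matrix_inv_unique) (simp add: orthogonal_matrix_def)

lemma geo_quadratic_form: "x \<bullet> (geo F l *v x) = (\<Sum>i\<in>UNIV. exp (l $ i) * ((transpose F *v x) $ i)\<^sup>2)"
proof -
  have "x \<bullet> (geo F l *v x) = (transpose F *v x) \<bullet> (diag_mat (\<chi> i. exp (l $ i)) *v (transpose F *v x))"
    by (simp add: geo_def matrix_vector_mul_assoc[symmetric] dot_lmul_matrix[symmetric])
  then show ?thesis by (simp add: diag_mat_vector inner_vec_def power2_eq_square mult_ac)
qed

lemma geo_in_pd_mats:
  assumes "invertible F" shows "geo F l \<in> pd_mats"
proof -
  have "transpose (geo F l) = geo F l"
    by (simp add: geo_def matrix_transpose_mul matrix_mul_assoc)
  moreover have "0 < x \<bullet> (geo F l *v x)" if "x \<noteq> 0" for x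
  proof -
    have "transpose F *v x \<noteq> 0"
      using assms that by (metis transpose_invertible invertible_def matrix_vector_mul_assoc matrix_vector_mul_lid matrix_vector_mult_0_right)
    then obtain i where "(transpose F *v x) $ i \<noteq> 0" by (metis vec_eq_iff zero_index)
    then show ?thesis unfolding geo_quadratic_form
      by (intro sum_pos2[of _ i]) auto
  qed
  ultimately show ?thesis by (simp add: pd_mats_def sym_mats_def)
qed

lemma geo_inverse_quadratic_form:
  assumes F: "invertible F"
  shows "y \<bullet> (matrix_inv (geo F l) *v y) = (\<Sum>i\<in>UNIV. exp (- l $ i) * ((matrix_inv F *v y) $ i)\<^sup>2)"
proof -
  let ?G = "transpose (matrix_inv F)"
  have ff: "F ** matrix_inv F = mat 1" "matrix_inv F ** F = mat 1"
    using matrix_inv_cancel[OF F] by auto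
  have dd: "diag_mat (\<chi> i. exp (l $ i)) ** diag_mat (\<chi> i. exp ((- l) $ i)) = mat 1"
    by (simp add: diag_mat_mult exp_add[symmetric] diag_mat_1)
  have gg: "transpose F ** ?G = mat 1" 
    by (metis ff(2) matrix_transpose_mul transpose_mat)
  have "geo F l ** geo ?G (- l) =
      F ** (diag_mat (\<chi> i. exp (l $ i)) ** (transpose F ** ?G) ** diag_mat (\<chi> i. exp ((- l) $ i))) ** matrix_inv F"
    by (simp add: geo_def matrix_mul_assoc)
  also have "\<dots> = mat 1" by (simp only: gg matrix_mul_rid dd ff)
  finally have *: "geo F l ** geo ?G (- l) = mat 1" .
  hence "matrix_inv (geo F l) = geo ?G (- l)" by (rule matrix_inv_unique)
  then show ?thesis by (simp add: geo_quadratic_form)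
qed

lemma pd_mats_geo_orthogonal:
  fixes A :: "real^'n^'n"
  assumes "A \<in> pd_mats"
  obtains R :: "real^'n^'n" and l where "orthogonal_matrix R" "A = geo R l"
proof -
  have sym: "transpose A = A" and pos: "\<And>x. x \<noteq> 0 \<Longrightarrow> 0 < x \<bullet> (A *v x)"
    using assms by (auto simp: pd_mats_def sym_mats_def)
  obtain R l where R: "orthogonal_matrix R" and A: "A = R ** diag_mat l ** transpose R"
    using symmetric_matrix_diagonalization[OF sym] .
  have "l $ i > 0" for i
  proof -
    have R1: "transpose R *v (R *v axis i 1) = axis i 1"
      using R by (simp add: matrix_vector_mul_assoc orthogonal_matrix_def)
    hence "R *v axis i 1 \<noteq> 0" by (metis axis_eq_0_iff matrix_vector_mult_0_right zero_neq_one)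
    from pos[OF this] have "0 < (transpose R *v (R *v axis i 1)) \<bullet> (diag_mat l *v (transpose R *v (R *v axis i 1)))"
      by (simp add: A matrix_vector_mul_assoc[symmetric] dot_lmul_matrix[symmetric])
    then show ?thesis unfolding R1 by (simp add: diag_mat_vector inner_axis')
  qed
  hence "(\<chi> i. exp ((\<chi> i. ln (l $ i)) $ i)) = l" by (simp add: vec_eq_iff)
  hence "A = geo R (\<chi> i. ln (l $ i))" unfolding geo_def A by simp
  then show thesis using that R by blast
qed

lemma pd_mats_factor:
  fixes A :: "real^'n^'n"
  assumes "A \<in> pd_mats"
  obtains C :: "real^'n^'n" where "invertible C" "A = C ** transpose C"
proof -
  obtain R l where R: "orthogonal_matrix R" "A = geo R l" using pd_mats_geo_orthogonal[OF assms] .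
  define D where "D = diag_mat (\<chi> i. exp (l $ i / 2))"
  have "A = geo (R ** D) 0" using geo_shift[of R l 0] R by (simp add: D_def)
  moreover have "det D \<noteq> 0" by (simp add: D_def det_diag_mat)
  hence "invertible (R ** D)"
    using R(1) by (intro invertible_mult[OF orthogonal_matrix_invertible]) (simp_all add: invertible_det_nz)
  ultimately show thesis using that[of "R ** D"] by (simp only: geo_0)
qed

text \<open>Relative to \<open>C C'\<close>, the matrix \<open>B\<close> becomes \<open>C\<^sup>-\<^sup>1 B C'\<^sup>-\<^sup>1\<close>, which is positive definite and has an
orthogonal diagonalization; the factor \<open>C R\<close> still represents \<open>C C'\<close>.\<close>

lemma pd_mats_geo_relative:
  fixes C :: "real^'n^'n"
  assumes "B \<in> pd_mats" "invertible C"
  obtains R :: "real^'n^'n" and l where "orthogonal_matrix R" "B = geo (C ** R) l"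
proof -
  let ?W = "matrix_inv C"
  have cc: "C ** ?W = mat 1" "?W ** C = mat 1" using matrix_inv_cancel[OF assms(2)] by auto
  obtain E :: "real^'n^'n" where E: "invertible E" "B = E ** transpose E" using pd_mats_factor[OF assms(1)] .
  have "invertible ?W" unfolding invertible_def using cc by blast
  hence "invertible (?W ** E)" using E(1) invertible_mult by blast
  have "geo (?W ** E) 0 \<in> pd_mats" by (rule geo_in_pd_mats) fact
  hence "?W ** B ** transpose ?W \<in> pd_mats"
    by (simp add: geo_0 E(2) matrix_transpose_mul matrix_mul_assoc)
  then obtain R l where R: "orthogonal_matrix R" "?W ** B ** transpose ?W = geo R l"
    using pd_mats_geo_orthogonal by blast
  have tt: "transpose ?W ** transpose C = mat 1" by (metis cc(1) matrix_transpose_mul transpose_mat)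
  have "B = (C ** ?W) ** B ** (transpose ?W ** transpose C)" by (simp only: cc tt matrix_mul_lid matrix_mul_rid)
  also have "\<dots> = C ** geo R l ** transpose C" by (simp only: matrix_mul_assoc R(2)[symmetric])
  also have "\<dots> = geo (C ** R) l" by (simp add: geo_def matrix_transpose_mul matrix_mul_assoc)
  finally show thesis using that R by blast
qed

lemma orthogonal_factor:
  fixes C R :: "real^'n^'n"
  assumes "orthogonal_matrix R"
  shows "(C ** R) ** transpose (C ** R) = C ** transpose C"
proof -
  have "(C ** R) ** transpose (C ** R) = C ** (R ** transpose R) ** transpose C"
    by (simp add: matrix_transpose_mul matrix_mul_assoc)
  then show ?thesis using assms by (simp add: orthogonal_matrix_def matrix_mul_rid)
qed

section \<open>One-dimensional inequalities for the loss function\<close>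

text \<open>\<open>scaled_sq l z\<close> is the quadratic form of the inverse of \<open>geo F l\<close> at \<open>F z\<close>, and \<open>- weighted_sq l z\<close>
is its derivative in the direction \<open>l\<close> at \<open>l = 0\<close>.\<close>

definition scaled_sq :: "real^'n \<Rightarrow> real^'n \<Rightarrow> real" where
  "scaled_sq l z = (\<Sum>i\<in>UNIV. exp (- l $ i) * (z $ i)\<^sup>2)"

definition weighted_sq :: "real^'n \<Rightarrow> real^'n \<Rightarrow> real" where
  "weighted_sq l z = (\<Sum>i\<in>UNIV. l $ i * (z $ i)\<^sup>2)"

lemma inner_self_sum_sq: "z \<bullet> z = (\<Sum>i\<in>UNIV. (z $ i)\<^sup>2)" for z :: "real^'n"
  by (simp add: inner_vec_def power2_eq_square)

lemma scaled_sq_nonneg: "scaled_sq l z \<ge> 0"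
  unfolding scaled_sq_def by (intro sum_nonneg) auto

lemma scaled_sq_pos:
  assumes "z \<noteq> 0" shows "0 < scaled_sq l z"
proof -
  obtain i where "z $ i \<noteq> 0" using assms by (auto simp: vec_eq_iff)
  then show ?thesis unfolding scaled_sq_def by (intro sum_pos2[of _ i]) auto
qed

lemma scaled_sq_bounds:
  fixes l z :: "real^'n"
  assumes "\<And>i. \<bar>l $ i\<bar> \<le> L"
  shows "exp (- L) * (z \<bullet> z) \<le> scaled_sq l z" "scaled_sq l z \<le> exp L * (z \<bullet> z)"
proof -
  have "- L \<le> - l $ i" "- l $ i \<le> L" for i using assms[of i] by auto
  then show "exp (- L) * (z \<bullet> z) \<le> scaled_sq l z" "scaled_sq l z \<le> exp L * (z \<bullet> z)"
    unfolding scaled_sq_def inner_self_sum_sq sum_distrib_left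
    by (auto intro!: sum_mono mult_right_mono)
qed

lemma abs_weighted_sq_le:
  fixes l z :: "real^'n"
  assumes "\<And>i. \<bar>l $ i\<bar> \<le> L"
  shows "\<bar>weighted_sq l z\<bar> \<le> L * (z \<bullet> z)"
  unfolding weighted_sq_def inner_self_sum_sq sum_distrib_left
  by (rule sum_abs[THEN order_trans]) (auto simp: abs_mult intro!: sum_mono mult_right_mono assms)

text \<open>Jensen's inequality for the exponential function and the weights \<open>z\<^sub>i\<^sup>2 / (z \<bullet> z)\<close>; it comes from
the tangent of \<open>exp\<close> at the mean \<open>- m\<close>, which \<open>exp\<close> meets only there.\<close>

lemma scaled_sq_jensen:
  fixes l z :: "real^'n"
  assumes "z \<noteq> 0"
  defines "m \<equiv> weighted_sq l z / (z \<bullet> z)"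
  shows "exp (- m) * (z \<bullet> z) \<le> scaled_sq l z"
    and "(\<exists>i. z $ i \<noteq> 0 \<and> l $ i \<noteq> m) \<Longrightarrow> exp (- m) * (z \<bullet> z) < scaled_sq l z"
proof -
  have s: "z \<bullet> z > 0" using assms(1) by simp
  have tangent: "exp (- m) * (1 + m - l $ i) \<le> exp (- l $ i)" for i
  proof -
    have "exp (- m) * (1 + (m - l $ i)) \<le> exp (- m) * exp (m - l $ i)"
      by (intro mult_left_mono exp_ge_add_one_self) auto
    then show ?thesis by (simp add: exp_add[symmetric] algebra_simps)
  qed
  have eq: "exp (- m) * (z \<bullet> z) = (\<Sum>i\<in>UNIV. exp (- m) * (1 + m - l $ i) * (z $ i)\<^sup>2)"
  proof -
    have "(\<Sum>i\<in>UNIV. exp (- m) * (1 + m - l $ i) * (z $ i)\<^sup>2)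
        = exp (- m) * ((1 + m) * (z \<bullet> z) - weighted_sq l z)"
      unfolding weighted_sq_def inner_self_sum_sq sum_distrib_left sum_subtractf[symmetric]
      by (intro sum.cong) (auto simp: algebra_simps)
    also have "weighted_sq l z = m * (z \<bullet> z)" using s by (simp add: m_def)
    finally show ?thesis by (simp add: algebra_simps)
  qed
  show "exp (- m) * (z \<bullet> z) \<le> scaled_sq l z"
    unfolding eq scaled_sq_def by (intro sum_mono mult_right_mono tangent) auto
  show "exp (- m) * (z \<bullet> z) < scaled_sq l z" if ex: "\<exists>i. z $ i \<noteq> 0 \<and> l $ i \<noteq> m"
  proof -
    obtain i where i: "z $ i \<noteq> 0" "l $ i \<noteq> m" using ex by blast
    have "exp (- m) * (1 + m - l $ i) \<noteq> exp (- l $ i)"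
    proof
      assume h: "exp (- m) * (1 + m - l $ i) = exp (- l $ i)"
      have "exp (m - l $ i) = exp m * exp (- l $ i)" by (simp add: exp_add[symmetric])
      also have "\<dots> = (exp m * exp (- m)) * (1 + m - l $ i)" unfolding h[symmetric] by simp
      also have "exp m * exp (- m) = 1" by (simp add: exp_add[symmetric])
      finally have "exp (m - l $ i) - 1 = m - l $ i" by simp
      hence "ln (exp (m - l $ i)) = exp (m - l $ i) - 1" by (simp only: ln_exp)
      hence "exp (m - l $ i) = 1" by (intro ln_eq_minus_one) auto
      then show False using i(2) by simp
    qed
    then show ?thesis using tangent[of i] i(1)
      unfolding eq scaled_sq_def
      by (intro sum_strict_mono_ex1 ballI mult_right_mono tangent bexI[of _ i]) auto
  qed
qed

locale scatter_loss =
  fixes u \<rho> :: "real \<Rightarrow> real" and a :: real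
  assumes u_nonneg: "\<And>s. 0 \<le> s \<Longrightarrow> 0 \<le> u s"
    and u_continuous: "continuous_on {0..} u"
    and u_antimono: "\<And>s t. 0 \<le> s \<Longrightarrow> s \<le> t \<Longrightarrow> u t \<le> u s"
    and su_strict_mono: "\<And>s t. 0 \<le> s \<Longrightarrow> s < t \<Longrightarrow> s * u s < t * u t"
    and su_less: "\<And>s. 0 \<le> s \<Longrightarrow> s * u s < a"
    and su_approaches: "\<And>b. b < a \<Longrightarrow> \<exists>s>0. b < s * u s"
    and rho_nonneg: "\<And>s. 0 \<le> s \<Longrightarrow> 0 \<le> \<rho> s"
    and rho_continuous: "continuous_on {0..} \<rho>"
    and rho_derivative: "\<And>s. 0 \<le> s \<Longrightarrow> (\<rho> has_real_derivative u s / 2) (at s within {0..})"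
begin

lemma a_pos: "0 < a" using su_less[of 0] by simp

lemma su_pos: "0 < s \<Longrightarrow> 0 < s * u s" using su_strict_mono[of 0 s] by simp

lemma su_mono: "0 \<le> s \<Longrightarrow> s \<le> t \<Longrightarrow> s * u s \<le> t * u t"
  using su_strict_mono[of s t] by (cases "s = t") auto

text \<open>This is strict convexity of \<open>x \<mapsto> \<rho> (exp x)\<close>: its derivative \<open>s u(s) / 2\<close>, \<open>s = exp x\<close>, is strictly
increasing, so the graph lies above its tangents.\<close>

lemma rho_above_tangent_strict:
  assumes s: "0 < s" and t: "0 < t" and ne: "t \<noteq> s"
  shows "s * u s / 2 * ln (t / s) < \<rho> t - \<rho> s"
proof -
  define g where "g x = \<rho> x - s * u s / 2 * ln x" for x
  have der: "DERIV g x :> (x * u x - s * u s) / (2 * x)" if "0 < x" for x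
  proof -
    have "at x within {0..} = at x" using that by (intro at_within_interior) simp
    hence "(\<rho> has_real_derivative u x / 2) (at x)" using rho_derivative[of x] that by simp
    then show ?thesis using that unfolding g_def
      by (auto intro!: derivative_eq_intros simp: field_simps)
  qed
  have cont: "continuous_on {x..y} g" if "0 < x" for x y
    using der that by (intro continuous_at_imp_continuous_on ballI DERIV_isCont[OF der]) auto
  have "g s < g t"
  proof (cases "s < t")
    case True
    then show ?thesis
    proof (rule DERIV_pos_imp_increasing_open)
      fix x assume "s < x" "x < t"
      then show "\<exists>y. DERIV g x :> y \<and> 0 < y"
        using der[of x] su_strict_mono[of s x] s by fastforce
    qed (use cont s in auto)
  next
    case False
    hence "t < s" using ne by simp
    then show ?thesis
    proof (rule DERIV_neg_imp_decreasing_open)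
      fix x assume "t < x" "x < s"
      then show "\<exists>y. DERIV g x :> y \<and> y < 0"
        using der[of x] su_strict_mono[of x s] t by (intro exI[of _ "(x * u x - s * u s) / (2 * x)"]) (auto simp: divide_neg_pos)
    qed (use cont t in auto)
  qed
  then show ?thesis using s t by (simp add: g_def ln_div algebra_simps diff_divide_distrib)
qed

lemma rho_above_tangent:
  assumes "0 < s" "0 < t"
  shows "s * u s / 2 * ln (t / s) \<le> \<rho> t - \<rho> s"
  using rho_above_tangent_strict[OF assms] assms by (cases "t = s") auto

lemma rho_mono:
  assumes "0 < s" "s \<le> t" shows "\<rho> s \<le> \<rho> t"
proof -
  have "0 \<le> s * u s / 2 * ln (t / s)" using assms u_nonneg[of s] by (intro mult_nonneg_nonneg) auto
  then show ?thesis using rho_above_tangent[of s t] assms by simp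
qed

lemma rho_log_lipschitz:
  assumes "0 < s" "s \<le> t"
  shows "\<rho> t - \<rho> s \<le> a / 2 * ln (t / s)"
proof -
  have t: "0 < t" using assms by simp
  have "\<rho> t - \<rho> s \<le> t * u t / 2 * ln (t / s)"
    using rho_above_tangent[of t s] assms t by (simp add: ln_div algebra_simps diff_divide_distrib)
  also have "\<dots> \<le> a / 2 * ln (t / s)" using su_less[of t] assms t
    by (intro mult_right_mono) auto
  finally show ?thesis .
qed

lemma rho_scaled_abs_le:
  fixes l z :: "real^'n"
  assumes L: "\<And>i. \<bar>l $ i\<bar> \<le> L"
  shows "\<bar>\<rho> (scaled_sq l z) - \<rho> (z \<bullet> z)\<bar> \<le> a / 2 * L"
proof (cases "z = 0")
  case True
  have "L \<ge> 0" using L[of undefined] by linarith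
  then show ?thesis using True a_pos by (simp add: scaled_sq_def)
next
  case False
  hence s: "0 < z \<bullet> z" by simp
  note b = scaled_sq_bounds[OF L, of z]
  have q: "0 < scaled_sq l z" by (rule scaled_sq_pos[OF False])
  have "scaled_sq l z / (z \<bullet> z) \<le> exp L" "(z \<bullet> z) / scaled_sq l z \<le> exp L"
    using b s q by (auto simp: field_simps exp_minus)
  hence ln: "ln (scaled_sq l z / (z \<bullet> z)) \<le> L" "ln ((z \<bullet> z) / scaled_sq l z) \<le> L"
    using s q by (metis divide_pos_pos exp_gt_zero ln_exp ln_le_cancel_iff)+
  show ?thesis
  proof (cases "z \<bullet> z \<le> scaled_sq l z")
    case True
    have "\<rho> (scaled_sq l z) - \<rho> (z \<bullet> z) \<le> a / 2 * L"
      using rho_log_lipschitz[OF s True] mult_left_mono[OF ln(1), of "a / 2"] a_pos by linarith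
    then show ?thesis using rho_mono[OF s True] by simp
  next
    case False
    hence le: "scaled_sq l z \<le> z \<bullet> z" by simp
    have "\<rho> (z \<bullet> z) - \<rho> (scaled_sq l z) \<le> a / 2 * L"
      using rho_log_lipschitz[OF q le] mult_left_mono[OF ln(2), of "a / 2"] a_pos by linarith
    then show ?thesis using rho_mono[OF q le] by simp
  qed
qed

text \<open>The convex increasing function \<open>x \<mapsto> \<rho> (exp x)\<close> is composed with the convex function
\<open>l \<mapsto> ln (scaled_sq l z)\<close>; the left-hand side is the derivative of the composition at \<open>l = 0\<close>.
Equality forces \<open>ln (scaled_sq l z)\<close> both to be unchanged and to be affine on the segment, hence
\<open>l\<^sub>i = 0\<close> wherever \<open>z\<^sub>i \<noteq> 0\<close>.\<close>

lemma rho_scaled_lower: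
  fixes l z :: "real^'n"
  shows "- (u (z \<bullet> z) * weighted_sq l z / 2) \<le> \<rho> (scaled_sq l z) - \<rho> (z \<bullet> z)" (is ?le)
    and "(\<exists>i. l $ i * z $ i \<noteq> 0) \<Longrightarrow>
      - (u (z \<bullet> z) * weighted_sq l z / 2) < \<rho> (scaled_sq l z) - \<rho> (z \<bullet> z)" (is "_ \<Longrightarrow> ?lt")
proof -
  have "?le \<and> ((\<exists>i. l $ i * z $ i \<noteq> 0) \<longrightarrow> ?lt)"
  proof (cases "z = 0")
    case True
    then show ?thesis by (simp add: scaled_sq_def weighted_sq_def)
  next
    case False
    define s where "s = z \<bullet> z"
    define q where "q = scaled_sq l z"
    define m where "m = weighted_sq l z / s"
    have s: "0 < s" using False by (simp add: s_def)
    have J: "exp (- m) * s \<le> q"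
      using scaled_sq_jensen(1)[OF False] by (simp add: q_def m_def s_def)
    have q: "0 < q" unfolding q_def by (rule scaled_sq_pos[OF False])
    have "exp (- m) \<le> q / s" using J s by (simp add: field_simps)
    hence lnm: "- m \<le> ln (q / s)" using q s by (simp add: ln_ge_iff)
    have w: "- (u s * weighted_sq l z / 2) = s * u s / 2 * (- m)" using s by (simp add: m_def)
    have su: "0 < s * u s / 2" using su_pos[OF s] by simp
    have le: "s * u s / 2 * (- m) \<le> s * u s / 2 * ln (q / s)"
      using su lnm by (intro mult_left_mono) auto
    have "s * u s / 2 * (- m) < \<rho> q - \<rho> s" if ex: "\<exists>i. l $ i * z $ i \<noteq> 0"
    proof (cases "q = s")
      case False
      then show ?thesis using rho_above_tangent_strict[OF s q] le by simp
    next
      case True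
      have "m \<noteq> 0"
      proof
        assume m: "m = 0"
        hence "\<exists>i. z $ i \<noteq> 0 \<and> l $ i \<noteq> m" using ex by auto
        from scaled_sq_jensen(2)[OF \<open>z \<noteq> 0\<close>, of l] this have "s < q"
          unfolding m_def[symmetric, unfolded s_def] m by (simp add: s_def q_def)
        then show False using True by simp
      qed
      hence "0 < m" using lnm True s by simp
      then show ?thesis using su True by (simp add: mult_pos_pos)
    qed
    moreover have "s * u s / 2 * (- m) \<le> \<rho> q - \<rho> s"
      using rho_above_tangent[OF s q] le by simp
    ultimately show ?thesis unfolding s_def[symmetric] q_def[symmetric] w by blast
  qed
  then show ?le "(\<exists>i. l $ i * z $ i \<noteq> 0) \<Longrightarrow> ?lt" by blast+
qed

text \<open>As \<open>u\<close> decreases and \<open>s u(s)\<close> increases, changing the argument by a factor changes \<open>u\<close> by at most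
that factor. This replaces any modulus of continuity of \<open>u\<close>.\<close>

lemma u_quasi_homogeneous:
  assumes "0 < s" "exp (- L) * s \<le> t" "t \<le> exp L * s" "0 \<le> L"
  shows "exp (- L) * u s \<le> u t" "u t \<le> exp L * u s"
proof -
  have "s \<le> exp L * s" "exp (- L) * s \<le> s" using assms by auto
  hence "s * u s \<le> exp L * s * u (exp L * s)" "exp (- L) * s * u (exp (- L) * s) \<le> s * u s"
    using su_mono[of s "exp L * s"] su_mono[of "exp (- L) * s" s] assms(1) by simp_all
  hence "s * u s \<le> s * (exp L * u (exp L * s))" "s * (exp (- L) * u (exp (- L) * s)) \<le> s * u s"
    by (simp_all only: mult_ac)
  hence "u s \<le> exp L * u (exp L * s)" "exp (- L) * u (exp (- L) * s) \<le> u s"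
    using assms(1) by (simp_all only: mult_le_cancel_left_pos)
  hence "exp (- L) * u s \<le> u (exp L * s)" "u (exp (- L) * s) \<le> exp L * u s"
    by (simp_all add: exp_minus field_simps)
  moreover have "u (exp L * s) \<le> u t" "u t \<le> u (exp (- L) * s)"
  proof -
    have "0 \<le> exp (- L) * s" using assms(1) by simp
    then show "u (exp L * s) \<le> u t" "u t \<le> u (exp (- L) * s)"
      using assms(2,3) by (auto intro: u_antimono)
  qed
  ultimately show "exp (- L) * u s \<le> u t" "u t \<le> exp L * u s" by linarith+
qed

text \<open>The lower bound, applied from the other end point of the segment, bounds the increment above by the
derivative at that end point; by quasi-homogeneity of \<open>u\<close> the derivatives at the two ends differ by
a multiple of \<open>L (exp (2 L) - 1)\<close> that does not depend on \<open>z\<close>.\<close>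

lemma rho_scaled_upper:
  fixes l z :: "real^'n"
  assumes L: "\<And>i. \<bar>l $ i\<bar> \<le> L"
  shows "\<rho> (scaled_sq l z) - \<rho> (z \<bullet> z)
    \<le> - (u (z \<bullet> z) * weighted_sq l z / 2) + a / 2 * (L * (exp (2 * L) - 1))"
proof (cases "z = 0")
  case True
  have "0 \<le> L" using L[of undefined] by linarith
  then show ?thesis using True a_pos by (simp add: scaled_sq_def weighted_sq_def)
next
  case False
  have L0: "0 \<le> L" using L[of undefined] by linarith
  define s where "s = z \<bullet> z"
  define q where "q = scaled_sq l z"
  have s: "0 < s" using False by (simp add: s_def)
  \<comment> \<open>In the coordinates \<open>y\<close> of the other end point, the displacement back to \<open>z\<close> is \<open>- l\<close>.\<close>
  define y :: "real^'n" where "y = (\<chi> i. exp (- l $ i / 2) * z $ i)"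
  have ysq: "(y $ i)\<^sup>2 = exp (- l $ i) * (z $ i)\<^sup>2" for i
    by (simp add: y_def power_mult_distrib power2_eq_square[of "exp _"] exp_add[symmetric])
  have yy: "y \<bullet> y = q" by (simp add: inner_self_sum_sq ysq q_def scaled_sq_def)
  have yq: "scaled_sq (- l) y = s"
    by (simp add: scaled_sq_def ysq s_def inner_self_sum_sq mult.assoc[symmetric] exp_add[symmetric])
  have "weighted_sq (- l) y = - (\<Sum>i\<in>UNIV. l $ i * exp (- l $ i) * (z $ i)\<^sup>2)"
    by (simp add: weighted_sq_def ysq sum_negf mult.assoc)
  with rho_scaled_lower(1)[where l = "- l" and z = y]
  have 1: "\<rho> q - \<rho> s \<le> - (u q / 2 * (\<Sum>i\<in>UNIV. l $ i * exp (- l $ i) * (z $ i)\<^sup>2))"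
    by (simp add: yy yq)
  note qb = scaled_sq_bounds[OF L, of z, folded q_def s_def]
  note uq = u_quasi_homogeneous[OF s qb L0]
  have us: "0 \<le> u s" using u_nonneg s by simp
  have *: "\<bar>u s - u q * exp (- l $ i)\<bar> \<le> u s * (exp (2 * L) - 1)" for i
  proof -
    have li: "exp (- L) \<le> exp (- l $ i)" "exp (- l $ i) \<le> exp L"
      using L[of i] by auto
    have "exp (- L) * u s * exp (- L) \<le> u q * exp (- l $ i)"
      using uq li us u_nonneg[OF scaled_sq_nonneg[of l z]] by (intro mult_mono) (auto simp: q_def)
    moreover have "u q * exp (- l $ i) \<le> exp L * u s * exp L"
      using uq li us by (intro mult_mono) auto
    moreover have "exp (2 * L) = exp L * exp L" "exp (- (2 * L)) = exp (- L) * exp (- L)"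
      by (simp_all add: mult_exp_exp)
    ultimately have b: "exp (- (2 * L)) * u s \<le> u q * exp (- l $ i)" "u q * exp (- l $ i) \<le> exp (2 * L) * u s"
      by (simp_all only: mult_ac)
    have "1 - exp (- (2 * L)) \<le> exp (2 * L) - 1"
    proof -
      have "2 * 1 \<le> exp (2 * L) + exp (- (2 * L))"
        using sum_squares_bound[of "exp L" "exp (- L)"]
        by (simp add: mult_exp_exp power2_eq_square mult.assoc)
      then show ?thesis by simp
    qed
    hence "u s * (1 - exp (- (2 * L))) \<le> u s * (exp (2 * L) - 1)" using us by (intro mult_left_mono)
    then show ?thesis using b by (simp add: abs_le_iff algebra_simps)
  qed
  have "u s * weighted_sq l z - u q * (\<Sum>i\<in>UNIV. l $ i * exp (- l $ i) * (z $ i)\<^sup>2)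
      = (\<Sum>i\<in>UNIV. l $ i * (u s - u q * exp (- l $ i)) * (z $ i)\<^sup>2)"
    unfolding weighted_sq_def sum_distrib_left sum_subtractf[symmetric]
    by (intro sum.cong) (auto simp: algebra_simps)
  also have "\<dots> \<le> (\<Sum>i\<in>UNIV. L * (u s * (exp (2 * L) - 1)) * (z $ i)\<^sup>2)"
  proof (intro sum_mono mult_right_mono)
    fix i
    have "l $ i * (u s - u q * exp (- l $ i)) \<le> \<bar>l $ i\<bar> * \<bar>u s - u q * exp (- l $ i)\<bar>"
      by (simp add: abs_mult[symmetric])
    also have "\<dots> \<le> L * (u s * (exp (2 * L) - 1))" by (intro mult_mono L * L0) auto
    finally show "l $ i * (u s - u q * exp (- l $ i)) \<le> L * (u s * (exp (2 * L) - 1))" .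
  qed auto
  also have "\<dots> = (s * u s) * (L * (exp (2 * L) - 1))"
    by (simp add: sum_distrib_left[symmetric] s_def inner_self_sum_sq)
  also have "\<dots> \<le> a * (L * (exp (2 * L) - 1))"
    using su_less[of s] s L0 by (intro mult_right_mono) auto
  finally have "- (u q / 2 * (\<Sum>i\<in>UNIV. l $ i * exp (- l $ i) * (z $ i)\<^sup>2))
      \<le> - (u s * weighted_sq l z / 2) + a / 2 * (L * (exp (2 * L) - 1))"
    by simp
  then show ?thesis using 1 by (simp add: q_def s_def)
qed

lemma u_weighted_abs_le:
  fixes l z :: "real^'n"
  assumes "\<And>i. \<bar>l $ i\<bar> \<le> L"
  shows "\<bar>u (z \<bullet> z) * weighted_sq l z\<bar> \<le> a * L"
proof -
  have L0: "0 \<le> L" using assms[of undefined] by linarith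
  have "\<bar>u (z \<bullet> z) * weighted_sq l z\<bar> \<le> u (z \<bullet> z) * (L * (z \<bullet> z))"
    using u_nonneg[of "z \<bullet> z"] abs_weighted_sq_le[OF assms, of z]
    by (auto simp: abs_mult intro!: mult_left_mono)
  also have "\<dots> = (z \<bullet> z) * u (z \<bullet> z) * L" by simp
  also have "\<dots> \<le> a * L" using su_less[of "z \<bullet> z"] L0 by (intro mult_right_mono) auto
  finally show ?thesis .
qed

end

section \<open>The objective along exponential coordinates\<close>

locale scatter_problem = scatter_loss +
  fixes Q :: "(real^'n) measure"
  assumes prob: "prob_space Q" and sets_Q: "sets Q = sets borel"
begin

sublocale prob_space Q by (rule prob)

lemma borel_measurable_Q: "borel_measurable Q = borel_measurable borel"
  by (intro measurable_cong_sets sets_Q refl)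

lemma integrable_of_continuous_bounded:
  fixes g :: "real^'n \<Rightarrow> real"
  assumes "continuous_on UNIV g" "\<And>y. \<bar>g y\<bar> \<le> K"
  shows "integrable Q g"
proof (rule integrable_const_bound[where B = K])
  show "g \<in> borel_measurable Q"
    using assms(1) by (simp add: borel_measurable_Q borel_measurable_continuous_onI)
qed (use assms(2) in auto)

lemma continuous_on_compose_half_line:
  fixes h :: "real^'n \<Rightarrow> real"
  assumes "continuous_on {0..} g" "continuous_on UNIV h" "\<And>y. 0 \<le> h y"
  shows "continuous_on UNIV (\<lambda>y. g (h y) :: real)"
  by (rule continuous_on_compose2[OF assms(1,2)]) (auto simp: assms(3))

lemma integrable_rho_scaled:
  fixes W :: "real^'n^'n"
  shows "integrable Q (\<lambda>y. \<rho> (scaled_sq l (W *v y)) - \<rho> ((W *v y) \<bullet> (W *v y)))"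
proof (rule integrable_of_continuous_bounded)
  show "continuous_on UNIV (\<lambda>y. \<rho> (scaled_sq l (W *v y)) - \<rho> ((W *v y) \<bullet> (W *v y)))"
    by (intro continuous_intros continuous_on_compose_half_line[OF rho_continuous])
       (auto simp: scaled_sq_nonneg scaled_sq_def intro!: continuous_intros sum_nonneg)
  show "\<bar>\<rho> (scaled_sq l (W *v y)) - \<rho> ((W *v y) \<bullet> (W *v y))\<bar> \<le> a / 2 * norm l" for y
    by (rule rho_scaled_abs_le) (rule component_le_norm_cart)
qed

lemma integrable_u_weighted:
  fixes W :: "real^'n^'n"
  shows "integrable Q (\<lambda>y. u ((W *v y) \<bullet> (W *v y)) * weighted_sq l (W *v y))"
proof (rule integrable_of_continuous_bounded)
  show "continuous_on UNIV (\<lambda>y. u ((W *v y) \<bullet> (W *v y)) * weighted_sq l (W *v y))"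
    by (intro continuous_intros continuous_on_compose_half_line[OF u_continuous])
       (auto simp: weighted_sq_def intro!: continuous_intros)
  show "\<bar>u ((W *v y) \<bullet> (W *v y)) * weighted_sq l (W *v y)\<bar> \<le> a * norm l" for y
    by (rule u_weighted_abs_le) (rule component_le_norm_cart)
qed

lemma integrable_Qh:
  assumes "A \<in> pd_mats"
  shows "integrable Q (\<lambda>y. \<rho> (y \<bullet> (matrix_inv A *v y)) - \<rho> (y \<bullet> y))"
proof -
  obtain R l where R: "orthogonal_matrix R" and A: "A = geo R l"
    using pd_mats_geo_orthogonal[OF assms] .
  have W: "matrix_inv R = transpose R" by (rule matrix_inv_orthogonal[OF R])
  have "(transpose R *v y) \<bullet> (transpose R *v y) = y \<bullet> y" for y
    using R by (simp only: dot_lmul_matrix[symmetric] vector_transpose_matrix transpose_transpose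
        matrix_vector_mul_assoc orthogonal_matrix_def matrix_vector_mul_lid)
  then show ?thesis
    using integrable_rho_scaled[of l "transpose R"]
    by (simp add: A geo_inverse_quadratic_form[OF orthogonal_matrix_invertible[OF R]] W scaled_sq_def)
qed

text \<open>The derivative of \<open>Qh\<close> at \<open>F F'\<close> in the direction of the curve \<open>t \<mapsto> geo F (t l)\<close>.\<close>

definition slope :: "real^'n^'n \<Rightarrow> real^'n \<Rightarrow> real" where
  "slope F l = (\<Sum>i\<in>UNIV. l $ i) / 2 -
     (LINT y|Q. u ((matrix_inv F *v y) \<bullet> (matrix_inv F *v y)) * weighted_sq l (matrix_inv F *v y)) / 2"

lemma weighted_sq_scaleR: "weighted_sq (c *\<^sub>R l) z = c * weighted_sq l z"
  by (simp add: weighted_sq_def sum_distrib_left mult.assoc)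

lemma slope_scaleR: "slope F (c *\<^sub>R l) = c * slope F l"
proof -
  have "u s * (c * w) = c * (u s * w)" for s w by simp
  then show ?thesis
    by (simp only: slope_def weighted_sq_scaleR)
       (simp add: sum_distrib_left[symmetric] algebra_simps)
qed

lemma abs_slope_le: "\<bar>slope F l\<bar> \<le> (real CARD('n) + a) / 2 * norm l"
proof -
  have "\<bar>\<Sum>i\<in>UNIV. l $ i\<bar> \<le> (\<Sum>i\<in>(UNIV::'n set). norm l)"
    by (rule sum_abs[THEN order_trans]) (intro sum_mono component_le_norm_cart)
  moreover have "\<bar>LINT y|Q. u ((matrix_inv F *v y) \<bullet> (matrix_inv F *v y)) * weighted_sq l (matrix_inv F *v y)\<bar> \<le> a * norm l"
  proof -
    let ?g = "\<lambda>y. u ((matrix_inv F *v y) \<bullet> (matrix_inv F *v y)) * weighted_sq l (matrix_inv F *v y)"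
    have b: "\<bar>?g y\<bar> \<le> a * norm l" for y by (rule u_weighted_abs_le) (rule component_le_norm_cart)
    have "\<bar>LINT y|Q. ?g y\<bar> \<le> (LINT y|Q. \<bar>?g y\<bar>)" using integral_norm_bound[of Q ?g] by simp
    also have "\<dots> \<le> (LINT y|Q. a * norm l)"
      by (intro integral_mono integrable_abs integrable_u_weighted b) simp
    finally show ?thesis by (simp add: prob_space)
  qed
  ultimately show ?thesis unfolding slope_def by (simp add: algebra_simps add_divide_distrib)
qed

lemma Qh_geo_diff:
  fixes F :: "real^'n^'n"
  assumes F: "invertible F"
  shows "Qh \<rho> Q (geo F l) - Qh \<rho> Q (F ** transpose F) = (\<Sum>i\<in>UNIV. l $ i) / 2 +
    (LINT y|Q. \<rho> (scaled_sq l (matrix_inv F *v y)) - \<rho> ((matrix_inv F *v y) \<bullet> (matrix_inv F *v y)))"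
proof -
  have dF: "(det F)\<^sup>2 > 0" using F by (simp add: invertible_det_nz)
  have ln: "ln (det (geo F m)) = ln ((det F)\<^sup>2) + (\<Sum>i\<in>UNIV. m $ i)" for m
    using dF by (simp add: det_geo ln_mult)
  note int = integrable_Qh[OF geo_in_pd_mats[OF F]]
  note q = geo_inverse_quadratic_form[OF F]
  have "Qh \<rho> Q (geo F l) - Qh \<rho> Q (geo F 0) = (\<Sum>i\<in>UNIV. l $ i) / 2 +
     (LINT y|Q. (\<rho> (y \<bullet> (matrix_inv (geo F l) *v y)) - \<rho> (y \<bullet> y))
        - (\<rho> (y \<bullet> (matrix_inv (geo F 0) *v y)) - \<rho> (y \<bullet> y)))"
    unfolding Bochner_Integration.integral_diff[OF int int]
    by (simp add: Qh_def ln add_divide_distrib)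
  then show ?thesis by (simp add: geo_0[symmetric] q scaled_sq_def inner_self_sum_sq)
qed

lemma Qh_above_slope:
  fixes F :: "real^'n^'n"
  assumes F: "invertible F"
  shows "slope F l \<le> Qh \<rho> Q (geo F l) - Qh \<rho> Q (F ** transpose F)"
proof -
  let ?z = "\<lambda>y. matrix_inv F *v y"
  have "(LINT y|Q. - (u (?z y \<bullet> ?z y) * weighted_sq l (?z y) / 2))
      \<le> (LINT y|Q. \<rho> (scaled_sq l (?z y)) - \<rho> (?z y \<bullet> ?z y))"
    by (intro integral_mono rho_scaled_lower(1) integrable_rho_scaled)
       (simp add: integrable_u_weighted)
  then show ?thesis unfolding Qh_geo_diff[OF F] slope_def by simp
qed

text \<open>Equality of the integrals would force \<open>f = g\<close> almost everywhere, and then \<open>Q\<close> would be concentrated on \<open>S\<close>.\<close>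

lemma integral_less_of_mass:
  fixes f g :: "real^'n \<Rightarrow> real"
  assumes f: "integrable Q f" and g: "integrable Q g" and le: "\<And>y. f y \<le> g y"
    and S: "closed S" "measure Q S < 1" and lt: "\<And>y. y \<notin> S \<Longrightarrow> f y < g y"
  shows "integral\<^sup>L Q f < integral\<^sup>L Q g"
proof (rule ccontr)
  assume "\<not> ?thesis"
  hence "integral\<^sup>L Q f = integral\<^sup>L Q g"
    using integral_mono[OF f g le] by simp
  hence "(LINT y|Q. g y - f y) = 0" using f g by simp
  hence "AE y in Q. g y - f y = 0"
    using integral_nonneg_eq_0_iff_AE[of Q "\<lambda>y. g y - f y"] f g le by auto
  hence "AE y in Q. y \<in> S"
    by eventually_elim (use lt in force)
  moreover have "S \<in> events" using S(1) by (simp add: sets_Q borel_closed)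
  ultimately have "prob S = 1" by (simp add: prob_eq_1)
  then show False using S(2) by simp
qed

lemma Qh_above_slope_strict:
  fixes F :: "real^'n^'n"
  assumes F: "invertible F" and mass: "measure Q {y. \<forall>i. l $ i * (matrix_inv F *v y) $ i = 0} < 1"
  shows "slope F l < Qh \<rho> Q (geo F l) - Qh \<rho> Q (F ** transpose F)"
proof -
  let ?z = "\<lambda>y. matrix_inv F *v y"
  define f where "f y = - (u (?z y \<bullet> ?z y) * weighted_sq l (?z y) / 2)" for y
  define g where "g y = \<rho> (scaled_sq l (?z y)) - \<rho> (?z y \<bullet> ?z y)" for y
  have f: "integrable Q f" unfolding f_def by (simp add: integrable_u_weighted)
  have g: "integrable Q g" unfolding g_def by (rule integrable_rho_scaled)
  have le: "f y \<le> g y" for y unfolding f_def g_def by (rule rho_scaled_lower(1))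
  have lt: "f y < g y" if "\<not> (\<forall>i. l $ i * ?z y $ i = 0)" for y
    unfolding f_def g_def using that by (intro rho_scaled_lower(2)) blast
  have "closed {y. \<forall>i. l $ i * ?z y $ i = 0}"
    by (intro closed_Collect_all closed_Collect_eq continuous_intros)
  from integral_less_of_mass[OF f g le this mass] have "integral\<^sup>L Q f < integral\<^sup>L Q g"
    using lt by blast
  then show ?thesis unfolding Qh_geo_diff[OF F] slope_def f_def g_def by simp
qed

lemma Qh_below_slope:
  fixes F :: "real^'n^'n"
  assumes F: "invertible F"
  shows "Qh \<rho> Q (geo F l) - Qh \<rho> Q (F ** transpose F)
    \<le> slope F l + a / 2 * (norm l * (exp (2 * norm l) - 1))"
proof -
  let ?z = "\<lambda>y. matrix_inv F *v y"
  have "(LINT y|Q. \<rho> (scaled_sq l (?z y)) - \<rho> (?z y \<bullet> ?z y)) \<le>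
     (LINT y|Q. - (u (?z y \<bullet> ?z y) * weighted_sq l (?z y) / 2) + a / 2 * (norm l * (exp (2 * norm l) - 1)))"
    by (intro integral_mono rho_scaled_upper integrable_rho_scaled component_le_norm_cart)
       (simp add: integrable_u_weighted)
  also have "\<dots> = - (LINT y|Q. u (?z y \<bullet> ?z y) * weighted_sq l (?z y)) / 2 + a / 2 * (norm l * (exp (2 * norm l) - 1))"
    by (simp add: integrable_u_weighted prob_space)
  finally show ?thesis unfolding Qh_geo_diff[OF F] slope_def by simp
qed

end

section \<open>Critical points are the global minimizers\<close>

lemma norm_matrix_vector_le: "norm (M *v x) \<le> norm M * norm x" for M :: "real^'m^'k"
proof -
  have "(norm (M *v x))\<^sup>2 = (\<Sum>i\<in>UNIV. ((M $ i) \<bullet> x)\<^sup>2)"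
    by (simp add: power2_norm_eq_inner inner_self_sum_sq matrix_vector_mul_component)
  also have "\<dots> \<le> (\<Sum>i\<in>UNIV. (norm (M $ i))\<^sup>2 * (norm x)\<^sup>2)"
    unfolding power2_norm_eq_inner by (intro sum_mono Cauchy_Schwarz_ineq)
  also have "\<dots> = (norm M * norm x)\<^sup>2"
  proof -
    have "(norm M)\<^sup>2 = (\<Sum>i\<in>UNIV. (norm (M $ i))\<^sup>2)"
      by (simp only: power2_norm_eq_inner inner_vec_def[of M])
    then show ?thesis by (simp add: power_mult_distrib sum_distrib_right)
  qed
  finally show ?thesis by (rule power2_le_imp_le) simp
qed

lemma abs_le_twice_abs_exp_minus_one:
  fixes x :: real assumes "\<bar>exp x - 1\<bar> \<le> 1 / 2" shows "\<bar>x\<bar> \<le> 2 * \<bar>exp x - 1\<bar>"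
proof (cases "0 \<le> x")
  case True
  moreover have "x \<le> exp x - 1" using exp_ge_add_one_self[of x] by (simp only: le_diff_eq add.commute)
  ultimately show ?thesis by (smt (verit))
next
  case False

  have "1 / 2 \<le> exp x" using abs_ge_minus_self[of "exp x - 1"] assms by linarith
  have "- x * exp x \<le> (exp (- x) - 1) * exp x"
    using exp_ge_add_one_self[of "- x"] by (intro mult_right_mono) auto
  also have "\<dots> = 1 - exp x" by (simp add: algebra_simps exp_minus)
  finally have "- x * exp x \<le> 1 - exp x" .
  moreover have "- x * (1/2) \<le> - x * exp x" using False \<open>1 / 2 \<le> exp x\<close> by (intro mult_left_mono) auto
  ultimately have "- x * (1/2) \<le> 1 - exp x" by (rule order_trans[rotated])
  also have "1 - exp x \<le> \<bar>exp x - 1\<bar>" using abs_ge_minus_self[of "exp x - 1"] by simp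
  finally show ?thesis using False by simp
qed

text \<open>If \<open>x\<close> is the vector with \<open>(C R)' x = e\<^sub>i\<close>, then the quadratic form of \<open>geo (C R) l - C C'\<close> at \<open>x\<close> is
\<open>exp l\<^sub>i - 1\<close>. The length of \<open>x\<close> is bounded in terms of \<open>C\<close> alone, because \<open>R\<close> is orthogonal; this makes the constants
uniform in \<open>R\<close>.\<close>

lemma geo_coordinates_lipschitz:
  fixes C :: "real^'n^'n"
  assumes C: "invertible C"
  obtains K d where "0 < K" "0 < d"
    "\<And>R l. orthogonal_matrix R \<Longrightarrow> norm (geo (C ** R) l - C ** transpose C) < d \<Longrightarrow>
       norm l \<le> K * norm (geo (C ** R) l - C ** transpose C)"
proof -
  define W where "W = transpose (matrix_inv C)"
  define k where "k = (norm W)\<^sup>2 + 1"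
  have k: "0 < k" by (simp add: k_def add_nonneg_pos)
  have cw: "transpose C ** W = mat 1"
    unfolding W_def by (metis matrix_inv_cancel(2)[OF C] matrix_transpose_mul transpose_mat)
  have main: "norm l \<le> (2 * real CARD('n) * k) * norm (geo (C ** R) l - C ** transpose C)"
    if R: "orthogonal_matrix R" and small: "norm (geo (C ** R) l - C ** transpose C) < 1 / (2 * k)" for R l
  proof -
    define M where "M = geo (C ** R) l - C ** transpose C"
    have li: "\<bar>l $ i\<bar> \<le> 2 * k * norm M" for i
    proof -
      define x where "x = W *v (R *v axis i 1)"
      have "transpose (C ** R) *v x = (transpose R ** (transpose C ** W) ** R) *v axis i 1"
        by (simp add: x_def matrix_transpose_mul matrix_vector_mul_assoc matrix_mul_assoc)
      hence t: "transpose (C ** R) *v x = axis i 1"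
        using R by (simp add: cw matrix_mul_rid orthogonal_matrix_def)
      have g: "x \<bullet> (geo (C ** R) m *v x) = exp (m $ i)" for m
        unfolding geo_quadratic_form t
        by (simp add: axis_def if_distrib[of "\<lambda>a. a\<^sup>2"] if_distrib[of "\<lambda>a. _ * a"] cong: if_cong)
      have "x \<bullet> (M *v x) = exp (l $ i) - 1"
        using g[of l] g[of 0]
        by (simp add: M_def geo_0 orthogonal_factor[OF R] matrix_vector_mult_diff_rdistrib inner_diff_right)
      moreover have "\<bar>x \<bullet> (M *v x)\<bar> \<le> k * norm M"
      proof -
        have "norm x \<le> norm W * norm (R *v axis i 1)" unfolding x_def by (rule norm_matrix_vector_le)
        also have "norm (R *v axis i 1) = 1"
        proof -
          have "orthogonal_transformation ((*v) R)" using R by (simp add: orthogonal_transformation_matrix)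
          then show ?thesis by (simp add: orthogonal_transformation_norm)
        qed
        finally have "norm x \<le> norm W" by simp
        from power_mono[OF this norm_ge_zero, of 2] have "(norm x)\<^sup>2 \<le> k" unfolding k_def by linarith
        moreover have "\<bar>x \<bullet> (M *v x)\<bar> \<le> norm x * (norm M * norm x)"
          by (rule Cauchy_Schwarz_ineq2[THEN order_trans]) (intro mult_left_mono norm_matrix_vector_le norm_ge_zero)
        ultimately show ?thesis
          using mult_right_mono[of "(norm x)\<^sup>2" k "norm M"] by (simp add: power2_eq_square mult_ac)
      qed
      ultimately have e: "\<bar>exp (l $ i) - 1\<bar> \<le> k * norm M" by simp
      also have "k * norm M \<le> 1 / 2" using small k by (simp add: M_def[symmetric] field_simps)
      finally have "\<bar>l $ i\<bar> \<le> 2 * \<bar>exp (l $ i) - 1\<bar>" by (rule abs_le_twice_abs_exp_minus_one)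
      also have "\<dots> \<le> 2 * (k * norm M)" using e by simp
      finally show ?thesis by simp
    qed
    have "norm l \<le> (\<Sum>i\<in>UNIV. \<bar>l $ i\<bar>)" by (rule norm_le_l1_cart)
    also have "\<dots> \<le> (\<Sum>i\<in>(UNIV::'n set). 2 * k * norm M)" by (intro sum_mono li)
    finally show ?thesis by (simp add: M_def mult_ac)
  qed
  show thesis by (rule that[OF _ _ main]) (use k in auto)
qed

lemma geo_sum: "geo F l = (\<Sum>k\<in>UNIV. exp (l $ k) *\<^sub>R (\<chi> i j. F $ i $ k * F $ j $ k))"
  by (simp add: vec_eq_iff geo_component mult_ac)

lemma invertible_mult_orthogonal:
  assumes "invertible C" "orthogonal_matrix R" shows "invertible (C ** R)"
  using assms by (intro invertible_mult orthogonal_matrix_invertible)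

lemma pd_mats_geo_near:
  fixes B :: "real^'n^'n"
  assumes "B \<in> pd_mats"
  obtains K d where "0 < K" "0 < d"
    "\<And>A. A \<in> pd_mats \<Longrightarrow> norm (A - B) < d \<Longrightarrow>
       \<exists>F l. invertible F \<and> B = F ** transpose F \<and> A = geo F l \<and> norm l \<le> K * norm (A - B) \<and> norm l \<le> 1"
proof -
  obtain C :: "real^'n^'n" where C: "invertible C" "B = C ** transpose C" using pd_mats_factor[OF assms] .
  obtain K d where K: "0 < K" and d: "0 < d" and
    *: "\<And>R l. orthogonal_matrix R \<Longrightarrow> norm (geo (C ** R) l - C ** transpose C) < d \<Longrightarrow>
       norm l \<le> K * norm (geo (C ** R) l - C ** transpose C)"
    using geo_coordinates_lipschitz[OF C(1)] by metis
  have "\<exists>F l. invertible F \<and> B = F ** transpose F \<and> A = geo F l \<and> norm l \<le> K * norm (A - B) \<and> norm l \<le> 1"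
    if A: "A \<in> pd_mats" "norm (A - B) < min d (1 / K)" for A
  proof -
    obtain R l where R: "orthogonal_matrix R" "A = geo (C ** R) l"
      using pd_mats_geo_relative[OF A(1) C(1)] .
    have 1: "norm l \<le> K * norm (A - B)" using *[OF R(1), of l] A(2) by (simp add: R(2) C(2))
    also have "\<dots> \<le> 1" using A(2) K by (simp add: field_simps)
    finally show ?thesis
      using 1 R C invertible_mult_orthogonal orthogonal_factor by metis
  qed
  then show thesis using that[of K "min d (1 / K)"] K d by simp
qed

context scatter_problem
begin

lemma Qh_below_slope_quadratic:
  assumes F: "invertible F" and l: "norm l \<le> 1"
  shows "Qh \<rho> Q (geo F l) - Qh \<rho> Q (F ** transpose F) \<le> slope F l + a * exp 2 * (norm l)\<^sup>2"
proof -
  have "1 + - (2 * norm l) \<le> exp (- (2 * norm l))" by (rule exp_ge_add_one_self)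
  hence "(1 - exp (- (2 * norm l))) * exp (2 * norm l) \<le> (2 * norm l) * exp 2"
    using l by (intro mult_mono) auto
  hence "exp (2 * norm l) - 1 \<le> 2 * norm l * exp 2"
    by (simp add: algebra_simps mult_exp_exp)
  hence "a / 2 * (norm l * (exp (2 * norm l) - 1)) \<le> a / 2 * (norm l * (2 * norm l * exp 2))"
    using a_pos by (intro mult_left_mono) auto
  then show ?thesis using Qh_below_slope[OF F, of l] by (simp add: power2_eq_square mult_ac)
qed

lemma continuous_on_Qh: "continuous_on pd_mats (Qh \<rho> Q)"
proof (unfold continuous_on_def, intro ballI)
  fix B :: "real^'n^'n" assume B: "B \<in> pd_mats"
  obtain K d where K: "0 < K" and d: "0 < d" and
    near: "\<And>A. A \<in> pd_mats \<Longrightarrow> norm (A - B) < d \<Longrightarrow>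
       \<exists>F l. invertible F \<and> B = F ** transpose F \<and> A = geo F l \<and> norm l \<le> K * norm (A - B) \<and> norm l \<le> 1"
    using pd_mats_geo_near[OF B] by metis
  define c where "c = (real CARD('n) + a) / 2 + a * exp 2"
  have c: "0 \<le> c" using a_pos by (simp add: c_def)
  have lip: "\<bar>Qh \<rho> Q A - Qh \<rho> Q B\<bar> \<le> c * K * norm (A - B)"
    if A: "A \<in> pd_mats" "norm (A - B) < d" for A
  proof -
    obtain F l where F: "invertible F" "B = F ** transpose F" "A = geo F l"
      and l: "norm l \<le> K * norm (A - B)" "norm l \<le> 1" using near[OF A] by blast
    have "(norm l)\<^sup>2 \<le> norm l" using l(2) by (simp add: power2_eq_square mult_left_le)
    hence "a * exp 2 * (norm l)\<^sup>2 \<le> a * exp 2 * norm l" using a_pos by (intro mult_left_mono) auto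
    moreover have "0 \<le> a * exp 2 * norm l" using a_pos by simp
    moreover have "c * norm l = (real CARD('n) + a) / 2 * norm l + a * exp 2 * norm l"
      by (simp add: c_def distrib_right)
    ultimately have "\<bar>Qh \<rho> Q A - Qh \<rho> Q B\<bar> \<le> c * norm l"
      using Qh_above_slope[OF F(1), of l] Qh_below_slope_quadratic[OF F(1) l(2)] abs_slope_le[of F l]
      unfolding F(2,3) by linarith
    also have "\<dots> \<le> c * (K * norm (A - B))" using l c by (intro mult_left_mono)
    finally show ?thesis by simp
  qed
  have "((\<lambda>A. c * K * norm (A - B)) \<longlongrightarrow> 0) (at B within pd_mats)"
    by (rule tendsto_eq_intros | simp)+
  moreover have "\<forall>\<^sub>F A in at B within pd_mats. norm (Qh \<rho> Q A - Qh \<rho> Q B) \<le> c * K * norm (A - B)"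
    unfolding eventually_at using d lip by (auto simp: dist_norm)
  ultimately have "((\<lambda>A. Qh \<rho> Q A - Qh \<rho> Q B) \<longlongrightarrow> 0) (at B within pd_mats)"
    by (rule Lim_null_comparison[rotated])
  then show "(Qh \<rho> Q \<longlongrightarrow> Qh \<rho> Q B) (at B within pd_mats)" by (simp add: LIM_zero_iff)
qed

text \<open>Along the curve, \<open>Qh\<close> minus its supporting line of slope \<open>slope F l\<close> has a minimum at \<open>0\<close>, while
its derivative there is \<open>- slope F l\<close> when the gradient of \<open>Qh\<close> vanishes.\<close>

lemma slope_eq_0_if_critical:
  assumes "has_sym_gradient (Qh \<rho> Q) 0 (F ** transpose F)" and F: "invertible F"
  shows "slope F l = 0"
proof -
  define p where "p s = geo F (s *\<^sub>R l)" for s :: real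
  have p0: "p 0 = F ** transpose F" by (simp add: p_def geo_0)
  obtain p' where "(p has_derivative p') (at 0)"
  proof -
    have "p = (\<lambda>s. \<Sum>k\<in>UNIV. exp (s * l $ k) *\<^sub>R (\<chi> i j. F $ i $ k * F $ j $ k))"
      by (simp add: p_def geo_sum fun_eq_iff)
    moreover have "((\<lambda>s. exp (s * c) *\<^sub>R M) has_derivative (\<lambda>h. (h * c) *\<^sub>R M)) (at 0)"
      for c and M :: "real^'n^'n"
      by (auto intro!: derivative_eq_intros)
    hence "((\<lambda>s. \<Sum>k\<in>UNIV. exp (s * l $ k) *\<^sub>R (\<chi> i j. F $ i $ k * F $ j $ k)) has_derivative
        (\<lambda>h. \<Sum>k\<in>UNIV. (h * l $ k) *\<^sub>R (\<chi> i j. F $ i $ k * F $ j $ k))) (at 0)"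
      by (intro has_derivative_sum)
    ultimately show thesis using that by simp
  qed
  moreover have "(Qh \<rho> Q has_derivative (\<lambda>H. 0 \<bullet> H)) (at (p 0) within range p)"
  proof (rule has_derivative_subset)
    show "(Qh \<rho> Q has_derivative (\<lambda>H. 0 \<bullet> H)) (at (p 0) within pd_mats)"
      using assms(1) by (simp add: p0 has_sym_gradient_def)
    show "range p \<subseteq> pd_mats" using geo_in_pd_mats[OF F] by (auto simp: p_def)
  qed
  ultimately have "(Qh \<rho> Q \<circ> p has_derivative (\<lambda>H. 0 \<bullet> H) \<circ> p') (at 0)"
    by (rule diff_chain_within)
  hence D: "((\<lambda>s. Qh \<rho> Q (p s)) has_real_derivative 0) (at 0)"
    by (simp add: has_field_derivative_def o_def lambda_zero)
  have "((\<lambda>s. Qh \<rho> Q (p s) - s * slope F l) has_real_derivative 0 - slope F l) (at 0)"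
    by (rule derivative_eq_intros D refl | simp)+
  moreover have "Qh \<rho> Q (p 0) - 0 * slope F l \<le> Qh \<rho> Q (p s) - s * slope F l" for s
    using Qh_above_slope[OF F, of "s *\<^sub>R l"] unfolding slope_scaleR by (simp add: p_def geo_0)
  ultimately have "0 - slope F l = 0"
    by (intro DERIV_local_min[of _ _ 0 1]) auto
  then show ?thesis by simp
qed

lemma slope_nonneg_if_minimal:
  assumes min: "\<And>A. A \<in> pd_mats \<Longrightarrow> Qh \<rho> Q (F ** transpose F) \<le> Qh \<rho> Q A" and F: "invertible F"
  shows "0 \<le> slope F l"
proof (rule tendsto_lowerbound)
  define c where "c = a * exp 2 * (norm l)\<^sup>2"
  show "((\<lambda>t. slope F l + t * c) \<longlongrightarrow> slope F l) (at_right 0)"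
    by (rule tendsto_eq_intros refl | simp)+
  have "0 \<le> slope F l + t * c" if t: "0 < t" "t < 1 / (norm l + 1)" for t
  proof -
    have "t * (norm l + 1) < 1" using t(2) by (simp add: field_simps add_pos_nonneg add_nonneg_pos)
    hence n: "norm (t *\<^sub>R l) \<le> 1" using t(1) by (simp add: algebra_simps)
    have "0 \<le> slope F (t *\<^sub>R l) + a * exp 2 * (norm (t *\<^sub>R l))\<^sup>2"
      using Qh_below_slope_quadratic[OF F n] min[OF geo_in_pd_mats[OF F], of "t *\<^sub>R l"] by linarith
    also have "\<dots> = t * (slope F l + t * c)"
      using t(1) by (simp add: slope_scaleR c_def power_mult_distrib power2_eq_square algebra_simps)
    finally show ?thesis using t(1) by (simp add: zero_le_mult_iff)
  qed
  then show "\<forall>\<^sub>F t in at_right 0. 0 \<le> slope F l + t * c"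
    by (intro eventually_at_rightI[of 0 "1 / (norm l + 1)"]) (auto simp: add_nonneg_pos)
qed simp

lemma slope_eq_0_if_minimal:
  assumes "\<And>A. A \<in> pd_mats \<Longrightarrow> Qh \<rho> Q (F ** transpose F) \<le> Qh \<rho> Q A" and F: "invertible F"
  shows "slope F l = 0"
  using slope_nonneg_if_minimal[OF assms, of l] slope_nonneg_if_minimal[OF assms, of "- l"]
    slope_scaleR[of F "- 1" l] by simp

text \<open>At a minimizer the slopes vanish, so the upper estimate leaves only a term quadratic in the distance.
As minimality also excludes negative increments, this is differentiability with gradient \<open>0\<close>.\<close>

lemma critical_if_minimal:
  assumes B: "B \<in> pd_mats" and min: "\<And>A. A \<in> pd_mats \<Longrightarrow> Qh \<rho> Q B \<le> Qh \<rho> Q A"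
  shows "has_sym_gradient (Qh \<rho> Q) 0 B"
proof -
  obtain K d where K: "0 < K" and d: "0 < d" and
    near: "\<And>A. A \<in> pd_mats \<Longrightarrow> norm (A - B) < d \<Longrightarrow>
       \<exists>F l. invertible F \<and> B = F ** transpose F \<and> A = geo F l \<and> norm l \<le> K * norm (A - B) \<and> norm l \<le> 1"
    using pd_mats_geo_near[OF B] by metis
  define c where "c = a * exp 2 * K\<^sup>2"
  have c: "0 < c" using a_pos K by (simp add: c_def)
  have quad: "\<bar>Qh \<rho> Q A - Qh \<rho> Q B\<bar> \<le> c * (norm (A - B))\<^sup>2"
    if A: "A \<in> pd_mats" "norm (A - B) < d" for A
  proof -
    obtain F l where F: "invertible F" "B = F ** transpose F" "A = geo F l"
      and l: "norm l \<le> K * norm (A - B)" "norm l \<le> 1" using near[OF A] by blast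
    have "slope F l = 0" using slope_eq_0_if_minimal[OF _ F(1)] min F(2) by simp
    hence "Qh \<rho> Q A - Qh \<rho> Q B \<le> a * exp 2 * (norm l)\<^sup>2"
      using Qh_below_slope_quadratic[OF F(1) l(2)] by (simp add: F(2,3))
    also have "\<dots> \<le> a * exp 2 * (K * norm (A - B))\<^sup>2"
      using l(1) a_pos by (intro mult_left_mono power_mono) auto
    finally show ?thesis using min[OF A(1)] by (simp add: c_def power_mult_distrib mult_ac)
  qed
  have "(Qh \<rho> Q has_derivative (\<lambda>H. 0 \<bullet> H)) (at B within pd_mats)"
    unfolding has_derivative_within_alt
  proof (intro conjI allI impI)
    show "bounded_linear (\<lambda>H :: real^'n^'n. 0 \<bullet> H)" by simp
    fix e :: real assume e: "0 < e"
    have "norm (Qh \<rho> Q A - Qh \<rho> Q B - 0 \<bullet> (A - B)) \<le> e * norm (A - B)"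
      if A: "A \<in> pd_mats" "norm (A - B) < min d (e / c)" for A
    proof -
      have "c * norm (A - B) \<le> e" using A(2) c by (simp add: field_simps)
      hence "c * norm (A - B) * norm (A - B) \<le> e * norm (A - B)" by (intro mult_right_mono) auto
      then show ?thesis using quad[of A] A by (simp add: power2_eq_square mult.assoc)
    qed
    then show "\<exists>d>0. \<forall>A\<in>pd_mats. norm (A - B) < d \<longrightarrow>
        norm (Qh \<rho> Q A - Qh \<rho> Q B - 0 \<bullet> (A - B)) \<le> e * norm (A - B)"
      using d e c by (intro exI[of _ "min d (e / c)"]) auto
  qed
  moreover have "(0 :: real^'n^'n) \<in> sym_mats" by (simp add: sym_mats_def transpose_def vec_eq_iff)
  ultimately show ?thesis by (simp add: has_sym_gradient_def)
qed

end

section \<open>Subspace masses: necessity and uniqueness\<close>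

lemma coordinate_subspace:
  fixes F :: "real^'n^'n" and P :: "'n set"
  assumes F: "invertible F"
  defines "H \<equiv> {y. \<forall>i\<in>P. (matrix_inv F *v y) $ i = 0}"
  shows "subspace H" "dim H + card P = CARD('n)"
proof -
  define S :: "(real^'n) set" where "S = {z. \<forall>i\<in>P. z $ i = 0}"
  have ff: "F *v (matrix_inv F *v y) = y" "matrix_inv F *v (F *v y) = y" for y
    using matrix_inv_cancel[OF F] by (simp_all add: matrix_vector_mul_assoc)
  have H: "H = (*v) F ` S"
    unfolding H_def S_def using ff by (auto simp: image_iff) metis
  have inj: "inj ((*v) F)" by (metis ff(2) injI)
  have S: "S = {z. \<forall>i. i \<notin> - P \<longrightarrow> z $ i = 0}" unfolding S_def by auto
  have "subspace S" unfolding S_def subspace_def by auto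
  then show "subspace H" unfolding H by (simp add: linear_subspace_image)
  have "dim H = dim S"
    unfolding H using inj by (intro dim_image_eq) (auto intro: inj_on_subset)
  also have "\<dots> = card (- P)"
    unfolding S dim_vec_eq[symmetric] by (rule dim_substandard_cart)
  finally show "dim H + card P = CARD('n)"
    using card_Un_disjoint[of "- P" P] by (simp add: Compl_partition2)
qed

lemma matrix_inv_mult_orthogonal:
  fixes C R :: "real^'n^'n"
  assumes "invertible C" "orthogonal_matrix R"
  shows "matrix_inv (C ** R) = transpose R ** matrix_inv C"
proof (rule matrix_inv_unique)
  have "C ** R ** (transpose R ** matrix_inv C) = C ** (R ** transpose R) ** matrix_inv C"
    by (simp add: matrix_mul_assoc)
  then show "C ** R ** (transpose R ** matrix_inv C) = mat 1"
    using assms by (simp add: orthogonal_matrix_def matrix_mul_rid matrix_inv_cancel)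
qed

text \<open>The columns of \<open>R\<close> indexed by \<open>P\<close> are an orthonormal basis of the orthogonal complement of \<open>H\<close>.\<close>

lemma orthogonal_matrix_adapted:
  fixes H :: "(real^'n) set"
  assumes "subspace H"
  obtains R :: "real^'n^'n" and P :: "'n set" where "orthogonal_matrix R" "card P + dim H = CARD('n)"
    "\<And>i y. i \<in> P \<Longrightarrow> y \<in> H \<Longrightarrow> (transpose R *v y) $ i = 0"
proof -
  define K where "K = {y \<in> UNIV. \<forall>x\<in>H. orthogonal x y}"
  have dK: "dim K + dim H = CARD('n)"
    using dim_subspace_orthogonal_to_vectors[OF assms subspace_UNIV] by (simp add: K_def)
  have "subspace K" unfolding K_def using subspace_orthogonal_to_vectors[of H] by simp
  then obtain B2 where B2: "B2 \<subseteq> K" "pairwise orthogonal B2" "\<And>x. x \<in> B2 \<Longrightarrow> norm x = 1"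
      "independent B2" "card B2 = dim K" "span B2 = K"
    using orthonormal_basis_subspace by blast
  obtain B1 where B1: "B1 \<subseteq> H" "pairwise orthogonal B1" "\<And>x. x \<in> B1 \<Longrightarrow> norm x = 1"
      "independent B1" "card B1 = dim H" "span B1 = H"
    using orthonormal_basis_subspace[OF assms] by blast
  have orth: "orthogonal x y" if "x \<in> B1" "y \<in> B2" for x y
    using that B1(1) B2(1) unfolding K_def by blast
  have disj: "B1 \<inter> B2 = {}"
  proof (rule ccontr)
    assume "B1 \<inter> B2 \<noteq> {}"
    then obtain x where "x \<in> B1" "x \<in> B2" by blast
    with orth[of x x] B1(3)[of x] show False by (auto simp: orthogonal_def)
  qed
  have "pairwise orthogonal (B1 \<union> B2)"
    using B1(2) B2(2) orth unfolding pairwise_def by (auto dest: orth simp: orthogonal_commute)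
  moreover have "norm b = 1" if "b \<in> B1 \<union> B2" for b using that B1(3) B2(3) by auto
  moreover have "card (B1 \<union> B2) = CARD('n)"
    using card_Un_disjoint[OF independent_imp_finite[OF B1(4)] independent_imp_finite[OF B2(4)] disj] B1(5) B2(5) dK by simp
  ultimately obtain R :: "real^'n^'n" where R: "orthogonal_matrix R"
      and bij: "bij_betw (\<lambda>i. column i R) UNIV (B1 \<union> B2)"
    using orthogonal_matrix_of_orthonormal_set by blast
  define P where "P = {i. column i R \<in> B2}"
  have "bij_betw (\<lambda>i. column i R) P B2"
    using bij unfolding P_def bij_betw_def by (auto intro: inj_on_subset)
  hence "card P = dim K" using B2(5) bij_betw_same_card by fastforce
  moreover have "(transpose R *v y) $ i = 0" if "i \<in> P" "y \<in> H" for i y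
  proof -
    have "orthogonal y (column i R)" using that B2(1) unfolding P_def K_def by blast
    moreover have "(transpose R *v y) $ i = column i R \<bullet> y"
      by (simp add: matrix_vector_mul_component transpose_def column_def inner_vec_def)
    ultimately show ?thesis by (simp add: orthogonal_def inner_commute)
  qed
  ultimately show thesis using that[OF R, of P] dK by simp
qed

context scatter_problem
begin

text \<open>With \<open>l\<close> the indicator of the coordinates that vanish on \<open>H\<close>, the equation \<open>slope F l = 0\<close> reads
\<open>d - dim H = \<integral> u(|z|\<^sup>2) (\<Sum>i\<in>P. z\<^sub>i\<^sup>2) dQ\<close>. The integrand is \<open>0\<close> on \<open>H\<close>, and elsewhere it is at most
\<open>|z|\<^sup>2 u(|z|\<^sup>2) < a\<close>.\<close>

lemma U_class_if_critical:
  assumes "A \<in> critical_points (Qh \<rho> Q)"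
  shows "Q \<in> U_class a"
proof -
  have A: "A \<in> pd_mats" "has_sym_gradient (Qh \<rho> Q) 0 A" using assms by (auto simp: critical_points_def)
  obtain C :: "real^'n^'n" where C: "invertible C" "A = C ** transpose C" using pd_mats_factor[OF A(1)] .
  have "measure Q H < 1 - (real CARD('n) - real (dim H)) / a"
    if H: "subspace H" "dim H < CARD('n)" for H :: "(real^'n) set"
  proof -
    let ?H = "(*v) (matrix_inv C) ` H"
    have "inj ((*v) (matrix_inv C))"
      using matrix_inv_cancel(1)[OF C(1)] by (metis injI matrix_vector_mul_assoc matrix_vector_mul_lid)
    hence dH: "dim ?H = dim H" by (intro dim_image_eq) (auto intro: inj_on_subset)
    have "subspace ?H" using H(1) by (simp add: linear_subspace_image)
    then obtain R :: "real^'n^'n" and P where R: "orthogonal_matrix R" and cP: "card P + dim H = CARD('n)"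
      and P: "\<And>i y. i \<in> P \<Longrightarrow> y \<in> ?H \<Longrightarrow> (transpose R *v y) $ i = 0"
      using orthogonal_matrix_adapted[of ?H] dH by metis
    define F where "F = C ** R"
    have F: "invertible F" unfolding F_def by (rule invertible_mult_orthogonal[OF C(1) R])
    have W: "matrix_inv F = transpose R ** matrix_inv C"
      unfolding F_def by (rule matrix_inv_mult_orthogonal[OF C(1) R])
    define l :: "real^'n" where "l = (\<chi> i. if i \<in> P then 1 else 0)"
    let ?z = "\<lambda>y. matrix_inv F *v y"
    define g where "g y = u (?z y \<bullet> ?z y) * weighted_sq l (?z y)" for y
    have "slope F l = 0"
      using A(2) by (intro slope_eq_0_if_critical[OF _ F]) (simp add: F_def orthogonal_factor[OF R] C(2))
    hence card: "real (card P) = integral\<^sup>L Q g"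
      unfolding slope_def g_def[abs_def] by (simp add: l_def sum.If_cases)
    have g: "integrable Q g" unfolding g_def by (rule integrable_u_weighted)
    have gH: "g y = 0" if "y \<in> H" for y
    proof -
      have "?z y $ i = 0" if "i \<in> P" for i
        using P[OF that] \<open>y \<in> H\<close> by (simp add: W matrix_vector_mul_assoc[symmetric])
      hence "weighted_sq l (?z y) = 0" unfolding weighted_sq_def l_def
        by (intro sum.neutral) auto
      then show ?thesis by (simp add: g_def)
    qed
    have ga: "g y < a" for y
    proof -
      have "weighted_sq l (?z y) \<le> ?z y \<bullet> ?z y"
        unfolding weighted_sq_def inner_self_sum_sq l_def by (intro sum_mono) auto
      hence "g y \<le> (?z y \<bullet> ?z y) * u (?z y \<bullet> ?z y)"
        unfolding g_def using u_nonneg by (simp add: mult.commute mult_right_mono)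
      then show ?thesis using su_less[of "?z y \<bullet> ?z y"] by simp
    qed
    have clH: "closed H" by (rule closed_subspace[OF H(1)])
    hence evH: "H \<in> events" by (simp add: sets_Q borel_closed)
    have spQ: "space Q = UNIV" using sets_eq_imp_space_eq[OF sets_Q] by simp
    define h where "h y = a * indicator (- H) y" for y :: "real^'n"
    have evcH: "- H \<in> events" using evH by (metis Compl_eq_Diff_UNIV sets.compl_sets spQ)
    have h: "integrable Q h" unfolding h_def
      using evcH by (intro integrable_mult_right integrable_real_indicator) (auto simp: emeasure_eq_measure)
    have "prob (- H) = 1 - prob H" using prob_compl[OF evH] by (simp add: spQ Compl_eq_Diff_UNIV)
    hence inth: "integral\<^sup>L Q h = a * (1 - prob H)" unfolding h_def using spQ by simp
    have le: "g y \<le> h y" for y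
      using gH ga[of y] by (auto simp: h_def indicator_def)
    have "prob H < 1"
    proof (rule ccontr)
      assume "\<not> ?thesis"
      hence "prob H = 1" using prob_le_1[of H] by simp
      hence "integral\<^sup>L Q h = 0" using inth by simp
      hence "integral\<^sup>L Q g \<le> 0" using integral_mono[OF g h le] by simp
      then show False using card cP H(2) by simp
    qed
    have "g y < h y" if "y \<notin> H" for y using ga that by (simp add: h_def)
    from integral_less_of_mass[OF g h le clH \<open>prob H < 1\<close> this]
    have "real (card P) < a * (1 - prob H)" unfolding card inth .
    moreover have "real (card P) = real CARD('n) - real (dim H)" using cP by linarith
    ultimately show ?thesis using a_pos by (simp add: field_simps)
  qed
  then show ?thesis using prob sets_Q by (simp add: U_class_def borel_prob_measures_def)
qed

lemma coordinate_subspace_mass: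
  fixes F :: "real^'n^'n"
  assumes U: "Q \<in> U_class a" and F: "invertible F" and P: "P \<noteq> {}"
  shows "real (card P) < a * (1 - prob {y. \<forall>i\<in>P. (matrix_inv F *v y) $ i = 0})"
proof -
  let ?H = "{y. \<forall>i\<in>P. (matrix_inv F *v y) $ i = 0}"
  note H = coordinate_subspace[OF F, of P]
  have "card P > 0" using P by (simp add: card_gt_0_iff)
  hence "prob ?H < 1 - (real CARD('n) - real (dim ?H)) / a"
    using U H unfolding U_class_def by auto
  moreover have "real CARD('n) - real (dim ?H) = real (card P)" using H(2) by linarith
  ultimately show ?thesis using a_pos by (simp add: field_simps)
qed

lemma critical_is_strict_minimum:
  assumes U: "Q \<in> U_class a" and B: "B \<in> critical_points (Qh \<rho> Q)" and A: "A \<in> pd_mats" "A \<noteq> B"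
  shows "Qh \<rho> Q B < Qh \<rho> Q A"
proof -
  have B: "B \<in> pd_mats" "has_sym_gradient (Qh \<rho> Q) 0 B" using B by (auto simp: critical_points_def)
  obtain C :: "real^'n^'n" where C: "invertible C" "B = C ** transpose C" using pd_mats_factor[OF B(1)] .
  obtain R :: "real^'n^'n" and l where R: "orthogonal_matrix R" and Al: "A = geo (C ** R) l"
    using pd_mats_geo_relative[OF A(1) C(1)] .
  define F where "F = C ** R"
  have F: "invertible F" unfolding F_def by (rule invertible_mult_orthogonal[OF C(1) R])
  have BF: "B = F ** transpose F" by (simp add: F_def orthogonal_factor[OF R] C(2))
  define P where "P = {i. l $ i \<noteq> 0}"
  have "l \<noteq> 0" using A(2) Al BF geo_0[of F] unfolding F_def by auto
  hence "P \<noteq> {}" by (auto simp: P_def vec_eq_iff)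
  from coordinate_subspace_mass[OF U F this]
  have "0 < a * (1 - prob {y. \<forall>i\<in>P. (matrix_inv F *v y) $ i = 0})" by linarith
  hence "prob {y. \<forall>i\<in>P. (matrix_inv F *v y) $ i = 0} < 1" using a_pos by (simp add: zero_less_mult_iff)
  moreover have "{y. \<forall>i\<in>P. (matrix_inv F *v y) $ i = 0} = {y. \<forall>i. l $ i * (matrix_inv F *v y) $ i = 0}"
    by (auto simp: P_def)
  ultimately have "slope F l < Qh \<rho> Q A - Qh \<rho> Q B"
    using Qh_above_slope_strict[OF F, of l] by (simp add: BF Al F_def)
  moreover have "slope F l = 0" using slope_eq_0_if_critical[OF _ F] B(2) BF by simp
  ultimately show ?thesis by simp
qed

end

section \<open>Growth along rays and existence of a minimizer\<close>

text \<open>The largest weight on the support of \<open>z\<close>, for nonnegative weights; coordinates off the support count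
as \<open>0\<close>, so that the value at \<open>z = 0\<close> is \<open>0\<close> too.\<close>

definition top_weight :: "real^'n \<Rightarrow> real^'n \<Rightarrow> real" where
  "top_weight m z = Max (range (\<lambda>i. if z $ i \<noteq> 0 then m $ i else 0))"

lemma top_weight_upper: "z $ i \<noteq> 0 \<Longrightarrow> m $ i \<le> top_weight m z"
  unfolding top_weight_def by (rule Max_ge) (auto intro: range_eqI[of _ _ i])

lemma top_weight_attained:
  assumes "top_weight m z \<noteq> 0"
  obtains i where "z $ i \<noteq> 0" "top_weight m z = m $ i"
proof -
  have "top_weight m z \<in> range (\<lambda>i. if z $ i \<noteq> 0 then m $ i else 0)"
    unfolding top_weight_def by (rule Max_in) auto
  then show thesis using that assms by (auto split: if_splits)
qed

lemma top_weight_nonneg: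
  assumes "\<And>i. 0 \<le> m $ i" shows "0 \<le> top_weight m z"
proof (cases "top_weight m z = 0")
  case False
  then obtain i where "top_weight m z = m $ i" by (rule top_weight_attained)
  then show ?thesis using assms by simp
qed simp

lemma top_weight_eqI:
  assumes "\<And>i. z $ i \<noteq> 0 \<Longrightarrow> m $ i \<le> x" "z $ k \<noteq> 0" "m $ k = x" "0 \<le> x"
  shows "top_weight m z = x"
  unfolding top_weight_def using assms by (intro Max_eqI) (auto intro: range_eqI[of _ _ k])

context scatter_problem
begin

text \<open>Lowering all nonzero weights by the smallest one, \<open>c\<close>, lowers the sum of the weights by \<open>c\<close> times the
number \<open>|P|\<close> of nonzero weights, and lowers \<open>top_weight\<close> by \<open>c\<close> exactly off the subspace where the
coordinates in \<open>P\<close> vanish. The class condition for that subspace compares the two, and the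
remaining weights have smaller support. Integrability goes along with the induction, because
\<open>top_weight\<close> is built up from indicators of subspaces.\<close>

lemma sum_le_expected_top_weight:
  fixes F :: "real^'n^'n" and m :: "real^'n"
  assumes U: "Q \<in> U_class a" and F: "invertible F" and m: "\<And>i. 0 \<le> m $ i"
  shows "integrable Q (\<lambda>y. top_weight m (matrix_inv F *v y)) \<and>
    (\<Sum>i\<in>UNIV. m $ i) \<le> a * (LINT y|Q. top_weight m (matrix_inv F *v y)) \<and>
    (m \<noteq> 0 \<longrightarrow> (\<Sum>i\<in>UNIV. m $ i) < a * (LINT y|Q. top_weight m (matrix_inv F *v y)))"
  using m
proof (induction "card {i. m $ i \<noteq> 0}" arbitrary: m rule: less_induct)
  case less
  show ?case
  proof (cases "m = 0")
    case True
    have "top_weight (0::real^'n) z = 0" for z by (metis top_weight_attained zero_index)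
    then show ?thesis using True by simp
  next
    case False
    define P where "P = {i. m $ i \<noteq> 0}"
    have P: "P \<noteq> {}" using False by (auto simp: P_def vec_eq_iff)
    obtain k where k: "k \<in> P" "\<And>i. i \<in> P \<Longrightarrow> m $ k \<le> m $ i"
      using ex_is_arg_min_if_finite[of P "\<lambda>i. m $ i"] P unfolding is_arg_min_def by (auto simp: not_less)
    define c where "c = m $ k"
    have c: "0 < c" using k(1) less.prems[of k] by (auto simp: c_def P_def)
    define m' :: "real^'n" where "m' = (\<chi> i. if i \<in> P then m $ i - c else 0)"
    have m': "0 \<le> m' $ i" for i using k(2) by (simp add: m'_def c_def)
    have "{i. m' $ i \<noteq> 0} \<subset> P" using k(1) by (auto simp: m'_def c_def split: if_splits)
    hence "card {i. m' $ i \<noteq> 0} < card {i. m $ i \<noteq> 0}"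
      unfolding P_def by (intro psubset_card_mono) auto
    note IH = less.hyps[OF this m']
    let ?H = "{y. \<forall>i\<in>P. (matrix_inv F *v y) $ i = 0}"
    have split: "top_weight m (matrix_inv F *v y) = top_weight m' (matrix_inv F *v y) + c * indicator (- ?H) y" for y
    proof (cases "y \<in> ?H")
      case True
      have "top_weight v (matrix_inv F *v y) = 0" if "\<And>i. i \<notin> P \<Longrightarrow> v $ i = 0" for v :: "real^'n"
      proof (rule ccontr)
        assume "top_weight v (matrix_inv F *v y) \<noteq> 0"
        then obtain i where "(matrix_inv F *v y) $ i \<noteq> 0" "v $ i \<noteq> 0"
          using top_weight_attained by metis
        then show False using True that by auto
      qed
      from this[of m] this[of m'] show ?thesis using True by (simp add: m'_def P_def)
    next
      case notH: False
      let ?z = "matrix_inv F *v y"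
      obtain j where j: "j \<in> P" "?z $ j \<noteq> 0" using notH by auto
      have mj: "m $ j = m' $ j + c" using j(1) by (simp add: m'_def)
      have up: "m $ i \<le> top_weight m' ?z + c" if "?z $ i \<noteq> 0" for i
        using top_weight_upper[OF that, of m'] top_weight_nonneg[OF m', of ?z] c
        by (cases "i \<in> P") (auto simp: m'_def P_def)
      have "top_weight m ?z = top_weight m' ?z + c"
      proof (cases "top_weight m' ?z = 0")
        case True
        have "m $ j = c" using top_weight_upper[OF j(2), of m'] m'[of j] mj True by simp
        then show ?thesis using True up j(2) c by (intro top_weight_eqI[of _ _ _ j]) auto
      next
        case False
        then obtain i where i: "?z $ i \<noteq> 0" "top_weight m' ?z = m' $ i" using top_weight_attained by metis
        have "i \<in> P" using False i(2) by (auto simp: m'_def split: if_splits)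
        hence "m $ i = top_weight m' ?z + c" using i(2) by (simp add: m'_def)
        then show ?thesis using up i(1) less.prems[of i] by (intro top_weight_eqI[of _ _ _ i]) auto
      qed
      then show ?thesis using notH by simp
    qed
    have "closed ?H" by (rule closed_subspace[OF coordinate_subspace(1)[OF F]])
    hence evH: "?H \<in> events" by (simp add: sets_Q borel_closed)
    have spQ: "space Q = UNIV" using sets_eq_imp_space_eq[OF sets_Q] by simp
    have evcH: "- ?H \<in> events" using sets.compl_sets[OF evH] by (simp only: spQ Compl_eq_Diff_UNIV)
    have ind: "integrable Q (\<lambda>y. c * indicator (- ?H) y)"
      using evcH by (intro integrable_mult_right integrable_real_indicator) (auto simp: emeasure_eq_measure)
    have pc: "prob (- ?H) = 1 - prob ?H" using prob_compl[OF evH] by (simp add: spQ Compl_eq_Diff_UNIV)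
    have int: "integrable Q (\<lambda>y. top_weight m (matrix_inv F *v y))"
      unfolding split using IH ind by (intro Bochner_Integration.integrable_add) auto
    have "(LINT y|Q. top_weight m (matrix_inv F *v y)) =
        (LINT y|Q. top_weight m' (matrix_inv F *v y)) + (LINT y|Q. c * indicator (- ?H) y)"
      unfolding split using IH ind by (intro Bochner_Integration.integral_add) auto
    also have "(LINT y|Q. c * indicator (- ?H) y) = c * (1 - prob ?H)" using pc spQ by simp
    finally have eq: "(LINT y|Q. top_weight m (matrix_inv F *v y)) =
        (LINT y|Q. top_weight m' (matrix_inv F *v y)) + c * (1 - prob ?H)" .
    have "a * (LINT y|Q. top_weight m (matrix_inv F *v y)) =
        a * (LINT y|Q. top_weight m' (matrix_inv F *v y)) + c * (a * (1 - prob ?H))"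
      unfolding eq by (simp add: algebra_simps)
    moreover have "c * real (card P) < c * (a * (1 - prob ?H))"
      using coordinate_subspace_mass[OF U F P] c by (intro mult_strict_left_mono)
    moreover have "(\<Sum>i\<in>UNIV. m $ i) = (\<Sum>i\<in>UNIV. m' $ i) + c * real (card P)"
    proof -
      have "m $ i = m' $ i + (if i \<in> P then c else 0)" for i by (simp add: m'_def P_def)
      then show ?thesis by (simp add: sum.distrib sum.If_cases)
    qed
    ultimately show ?thesis using IH int by linarith
  qed
qed

text \<open>With \<open>M\<close> the value of \<open>top_weight\<close>, the form \<open>scaled_sq (n l) z\<close> is at most a constant times
\<open>exp (n M)\<close>, and also at least such a multiple if \<open>M > 0\<close>; and \<open>\<rho> (exp x)\<close> has the asymptotic slope
\<open>a / 2\<close>, since \<open>s u(s) \<longlonglongrightarrow> a\<close>. If \<open>M = 0\<close>, the form may tend to \<open>0\<close>, but \<open>\<rho> \<ge> 0\<close> keeps the quotient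
from becoming negative in the limit.\<close>

lemma scaled_sq_growth:
  fixes l z :: "real^'n"
  defines "m \<equiv> (\<chi> i. max 0 (- l $ i))"
  shows "(\<lambda>n. (\<rho> (scaled_sq (real n *\<^sub>R l) z) - \<rho> (z \<bullet> z)) / real n) \<longlonglongrightarrow> a / 2 * top_weight m z"
proof (cases "z = 0")
  case True
  then show ?thesis by (simp add: scaled_sq_def top_weight_def)
next
  case False
  define M where "M = top_weight m z"
  define s where "s = z \<bullet> z"
  define q where "q n = scaled_sq (real n *\<^sub>R l) z" for n
  have s: "0 < s" using False by (simp add: s_def)
  have M: "0 \<le> M" unfolding M_def by (rule top_weight_nonneg) (simp add: m_def)
  have q: "0 < q n" for n unfolding q_def by (rule scaled_sq_pos[OF False])
  have "q n \<le> exp (real n * M) * s" for n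
    unfolding q_def scaled_sq_def s_def inner_self_sum_sq sum_distrib_left
  proof (intro sum_mono)
    fix i
    show "exp (- (real n *\<^sub>R l) $ i) * (z $ i)\<^sup>2 \<le> exp (real n * M) * (z $ i)\<^sup>2"
    proof (cases "z $ i = 0")
      case False
      have "- l $ i \<le> M" using top_weight_upper[OF False, of m] by (simp add: M_def m_def)
      hence "real n * (- l $ i) \<le> real n * M" by (intro mult_left_mono) auto
      then show ?thesis by (intro mult_right_mono) auto
    qed simp
  qed
  hence up: "(\<rho> (q n) - \<rho> s) / real n \<le> a / 2 * M" if "0 < n" for n
  proof -
    have "s \<le> exp (real n * M) * s" using s M by simp
    from rho_log_lipschitz[OF s this]
    have "\<rho> (exp (real n * M) * s) - \<rho> s \<le> a / 2 * (real n * M)" using s by simp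
    moreover have "\<rho> (q n) \<le> \<rho> (exp (real n * M) * s)" by (rule rho_mono[OF q]) fact
    ultimately show ?thesis using that by (simp add: field_simps)
  qed
  have const: "(\<lambda>n. x + c / real n) \<longlonglongrightarrow> x" for x c :: real
    using tendsto_add[OF tendsto_const lim_const_over_n[of c], of x] by simp
  have "(\<lambda>n. (\<rho> (q n) - \<rho> s) / real n) \<longlonglongrightarrow> a / 2 * M"
  proof (rule order_tendstoI)
    fix x assume x: "a / 2 * M < x"
    show "\<forall>\<^sub>F n in sequentially. (\<rho> (q n) - \<rho> s) / real n < x"
      using eventually_gt_at_top[of 0] by eventually_elim (rule le_less_trans[OF up x])
  next
    fix x assume x: "x < a / 2 * M"
    \<comment> \<open>A minorant whose limit \<open>b\<close> exceeds \<open>x\<close>: for \<open>M > 0\<close>, a supporting line of \<open>\<rho> (exp x)\<close>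
       whose slope \<open>r u(r) / 2\<close> is close enough to \<open>a / 2\<close>.\<close>
    have "\<exists>b c. x < b \<and> (\<forall>n>0. b + c / real n \<le> (\<rho> (q n) - \<rho> s) / real n)"
    proof (cases "M = 0")
      case True
      have "0 + (- \<rho> s) / real n \<le> (\<rho> (q n) - \<rho> s) / real n" for n
        using divide_right_mono[of "- \<rho> s" "\<rho> (q n) - \<rho> s" "real n"] rho_nonneg[of "q n"] q[of n] by simp
      then show ?thesis using x True by (intro exI[of _ 0] exI[of _ "- \<rho> s"]) auto
    next
      case False
      then obtain k where k: "z $ k \<noteq> 0" "M = m $ k" unfolding M_def using top_weight_attained by metis
      have lk: "- l $ k = M" using k(2) False M by (simp add: m_def max_def split: if_splits)
      have "2 * x / M < a" using x M False by (simp add: field_simps)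
      then obtain r where r: "0 < r" "2 * x / M < r * u r" using su_approaches by blast
      define c where "c = r * u r"
      have c: "0 < c" "x < c / 2 * M" using r su_pos[OF r(1)] M False by (auto simp: c_def field_simps)
      have "c / 2 * M + (\<rho> r + c / 2 * ln ((z $ k)\<^sup>2 / r) - \<rho> s) / real n \<le> (\<rho> (q n) - \<rho> s) / real n"
        if n: "0 < n" for n
      proof -
        have "exp (- (real n *\<^sub>R l) $ k) * (z $ k)\<^sup>2 \<le> q n"
          unfolding q_def scaled_sq_def by (rule member_le_sum) auto
        hence "exp (real n * M) * ((z $ k)\<^sup>2 / r) \<le> q n / r"
          using r(1) by (simp add: lk[symmetric] divide_right_mono)
        hence "ln (exp (real n * M) * ((z $ k)\<^sup>2 / r)) \<le> ln (q n / r)"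
          using q[of n] r(1) k(1) by (subst ln_le_cancel_iff) auto
        also have "ln (exp (real n * M) * ((z $ k)\<^sup>2 / r)) = real n * M + ln ((z $ k)\<^sup>2 / r)"
          using r(1) k(1) by (subst ln_mult) auto
        finally have "c / 2 * (real n * M + ln ((z $ k)\<^sup>2 / r)) \<le> c / 2 * ln (q n / r)"
          using c(1) by (intro mult_left_mono) auto
        also have "\<dots> \<le> \<rho> (q n) - \<rho> r" unfolding c_def by (rule rho_above_tangent[OF r(1) q])
        finally have "c / 2 * M * real n + (\<rho> r + c / 2 * ln ((z $ k)\<^sup>2 / r) - \<rho> s) \<le> \<rho> (q n) - \<rho> s"
          by (simp add: algebra_simps)
        then have "(c / 2 * M * real n + (\<rho> r + c / 2 * ln ((z $ k)\<^sup>2 / r) - \<rho> s)) / real n \<le> (\<rho> (q n) - \<rho> s) / real n"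
          by (rule divide_right_mono) simp
        then show ?thesis using n by (simp add: add_divide_distrib)
      qed
      then show ?thesis using c(2) by blast
    qed
    then obtain b c where b: "x < b" "\<And>n. 0 < n \<Longrightarrow> b + c / real n \<le> (\<rho> (q n) - \<rho> s) / real n" by blast
    from order_tendstoD(1)[OF const b(1), of c] eventually_gt_at_top[of 0]
    show "\<forall>\<^sub>F n in sequentially. x < (\<rho> (q n) - \<rho> s) / real n"
      by eventually_elim (rule less_le_trans[OF _ b(2)])
  qed
  then show ?thesis by (simp add: q_def s_def M_def)
qed

text \<open>Otherwise dominated convergence gives \<open>\<Sum>i. l\<^sub>i + a \<integral> top_weight m \<le> 0\<close> for \<open>m = l\<^sup>-\<close>, whereas
\<open>a \<integral> top_weight m\<close> is at least \<open>\<Sum>i. m\<^sub>i\<close>, and more if \<open>m \<noteq> 0\<close>; if \<open>m = 0\<close>, then \<open>\<Sum>i. l\<^sub>i > 0\<close> alone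
is a contradiction.\<close>

lemma Qh_exceeds_along_ray:
  fixes F :: "real^'n^'n" and l :: "real^'n"
  assumes U: "Q \<in> U_class a" and F: "invertible F" and l: "l \<noteq> 0"
  shows "\<exists>n. Qh \<rho> Q (F ** transpose F) < Qh \<rho> Q (geo F (real n *\<^sub>R l))"
proof (rule ccontr)
  assume "\<not> ?thesis"
  hence le: "Qh \<rho> Q (geo F (real n *\<^sub>R l)) \<le> Qh \<rho> Q (F ** transpose F)" for n by (simp add: not_less)
  let ?z = "\<lambda>y. matrix_inv F *v y"
  define m where "m = (\<chi> i. max 0 (- l $ i))"
  define g where "g n y = (\<rho> (scaled_sq (real n *\<^sub>R l) (?z y)) - \<rho> (?z y \<bullet> ?z y)) / real n" for n y
  have m: "0 \<le> m $ i" for i by (simp add: m_def)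
  note W = sum_le_expected_top_weight[OF U F m]
  have gint: "integrable Q (g n)" for n
    unfolding g_def by (intro integrable_divide integrable_rho_scaled)
  have "(\<lambda>n. integral\<^sup>L Q (g n)) \<longlonglongrightarrow> (LINT y|Q. a / 2 * top_weight m (?z y))"
  proof (rule integral_dominated_convergence)
    show "(\<lambda>y. a / 2 * top_weight m (?z y)) \<in> borel_measurable Q" using W by auto
    show "g n \<in> borel_measurable Q" for n using gint by auto
    show "integrable Q (\<lambda>y. a / 2 * norm l)" by simp
    show "AE y in Q. (\<lambda>n. g n y) \<longlonglongrightarrow> a / 2 * top_weight m (?z y)"
      unfolding g_def m_def by (intro AE_I2 scaled_sq_growth)
    have "\<bar>g n y\<bar> \<le> a / 2 * norm l" for n y
    proof (cases "n = 0")
      case True then show ?thesis using a_pos by (simp add: g_def)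
    next
      case False
      have "\<bar>\<rho> (scaled_sq (real n *\<^sub>R l) (?z y)) - \<rho> (?z y \<bullet> ?z y)\<bar> \<le> a / 2 * norm (real n *\<^sub>R l)"
        by (intro rho_scaled_abs_le component_le_norm_cart)
      then show ?thesis using False by (simp add: g_def field_simps)
    qed
    then show "AE y in Q. norm (g n y) \<le> a / 2 * norm l" for n by simp
  qed
  moreover have "integral\<^sup>L Q (g n) \<le> - (\<Sum>i\<in>UNIV. l $ i) / 2" if "0 < n" for n
  proof -
    have "real n * integral\<^sup>L Q (g n) + real n * (\<Sum>i\<in>UNIV. l $ i) / 2 \<le> 0"
      using le[of n] Qh_geo_diff[OF F, of "real n *\<^sub>R l"] that
      by (simp add: g_def[abs_def] sum_distrib_left[symmetric])
    hence "real n * (integral\<^sup>L Q (g n) + (\<Sum>i\<in>UNIV. l $ i) / 2) \<le> 0" by (simp add: algebra_simps)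
    then show ?thesis using that by (simp add: mult_le_0_iff)
  qed
  hence "\<forall>\<^sub>F n in sequentially. integral\<^sup>L Q (g n) \<le> - (\<Sum>i\<in>UNIV. l $ i) / 2"
    by (rule eventually_mono[OF eventually_gt_at_top[of 0]])
  ultimately have "(LINT y|Q. a / 2 * top_weight m (?z y)) \<le> - (\<Sum>i\<in>UNIV. l $ i) / 2"
    by (rule tendsto_upperbound) simp
  hence neg: "a * (LINT y|Q. top_weight m (?z y)) + (\<Sum>i\<in>UNIV. l $ i) \<le> 0" by simp
  have ml: "0 \<le> l $ i + m $ i" for i by (simp add: m_def)
  hence sml: "0 \<le> (\<Sum>i\<in>UNIV. l $ i) + (\<Sum>i\<in>UNIV. m $ i)"
    unfolding sum.distrib[symmetric] by (intro sum_nonneg)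
  show False
  proof (cases "m = 0")
    case False
    then show False using W neg sml by linarith
  next
    case True
    obtain k where k: "l $ k \<noteq> 0" using l by (auto simp: vec_eq_iff)
    have "0 \<le> l $ i" for i using ml[of i] True by simp
    hence "0 < (\<Sum>i\<in>UNIV. l $ i)" using k by (intro sum_pos2[of _ k]) (auto simp: order_less_le)
    then show False using W neg True by simp
  qed
qed

text \<open>A convex function that does not exceed its initial value at time \<open>T\<close> has not exceeded it before.\<close>

lemma Qh_sublevel_along_ray:
  fixes F :: "real^'n^'n" and l :: "real^'n"
  assumes F: "invertible F" and t: "0 \<le> t" "t \<le> T" and le: "Qh \<rho> Q (geo F (T *\<^sub>R l)) \<le> Qh \<rho> Q (F ** transpose F)"
  shows "Qh \<rho> Q (geo F (t *\<^sub>R l)) \<le> Qh \<rho> Q (F ** transpose F)"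
proof (rule ccontr)
  assume gt: "\<not> ?thesis"
  define G where "G = F ** diag_mat (\<chi> i. exp ((t *\<^sub>R l) $ i / 2))"
  have "det G \<noteq> 0" using F unfolding G_def by (simp add: det_mul det_diag_mat invertible_det_nz)
  hence G: "invertible G" by (simp add: invertible_det_nz)
  have geoG: "geo G v = geo F (t *\<^sub>R l + v)" for v unfolding G_def by (rule geo_shift)
  have GG: "G ** transpose G = geo F (t *\<^sub>R l)" using geoG[of 0] geo_0[of G] by simp
  have "slope G ((- t) *\<^sub>R l) \<le> Qh \<rho> Q (geo F 0) - Qh \<rho> Q (geo F (t *\<^sub>R l))"
    using Qh_above_slope[OF G, of "(- t) *\<^sub>R l"] unfolding GG geoG by simp
  hence "0 < t * slope G l" using gt by (simp add: slope_scaleR geo_0 del: scaleR_minus_left)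
  hence "0 \<le> slope G l" using t(1) by (simp add: zero_less_mult_iff)
  hence "0 \<le> slope G ((T - t) *\<^sub>R l)" using t(2) by (simp add: slope_scaleR)
  also have "slope G ((T - t) *\<^sub>R l) \<le> Qh \<rho> Q (geo F (T *\<^sub>R l)) - Qh \<rho> Q (geo F (t *\<^sub>R l))"
    using Qh_above_slope[OF G, of "(T - t) *\<^sub>R l"] unfolding GG geoG by (simp add: scaleR_diff_left)
  finally show False using gt le by simp
qed

end

lemma compact_orthogonal_matrices: "compact {R :: real^'n^'n. orthogonal_matrix R}"
proof -
  have "norm R \<le> real CARD('n)" if "orthogonal_matrix R" for R :: "real^'n^'n"
  proof -
    have "norm (R $ i) = 1" for i
      using that unfolding orthogonal_matrix_orthonormal_rows by (simp add: row_def vec_lambda_eta)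
    then show ?thesis
      unfolding norm_vec_def[of R] using L2_set_le_sum[of UNIV "\<lambda>i. norm (R $ i)"] by simp
  qed
  hence "bounded {R :: real^'n^'n. orthogonal_matrix R}" by (auto simp: bounded_iff)
  moreover have "closed {R :: real^'n^'n. orthogonal_matrix R}"
    unfolding orthogonal_matrix vec_eq_iff matrix_matrix_mult_def transpose_def vec_lambda_beta
    by (intro closed_Collect_all closed_Collect_eq continuous_intros)
  ultimately show ?thesis by (simp add: compact_eq_bounded_closed)
qed

lemma continuous_on_geo:
  "continuous_on UNIV (\<lambda>p :: (real^'n^'n) \<times> (real^'n). geo (fst p) (c *\<^sub>R snd p))"
  unfolding geo_sum by (intro continuous_intros)

context scatter_problem
begin

lemma continuous_on_Qh_geo:
  "continuous_on ({R. orthogonal_matrix R} \<times> UNIV) (\<lambda>p. Qh \<rho> Q (geo (fst p) (c *\<^sub>R snd p)))"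
  by (rule continuous_on_compose2[OF continuous_on_Qh continuous_on_subset[OF continuous_on_geo]])
     (auto intro: geo_in_pd_mats[OF orthogonal_matrix_invertible])

lemma Qh_identity: "Qh \<rho> Q (mat 1) = 0"
proof -
  have "matrix_inv (mat 1 :: real^'n^'n) = mat 1" by (rule matrix_inv_unique) (simp add: matrix_mul_lid)
  then show ?thesis by (simp add: Qh_def)
qed

text \<open>If \<open>Qh \<le> 0\<close> at points of rays arbitrarily far out, then by convexity \<open>Qh \<le> 0\<close> on ever longer initial
segments of these rays, hence on the whole of a limiting ray, whose existence is due to compactness.
No limiting ray can have this property.\<close>

lemma Qh_coercive:
  assumes U: "Q \<in> U_class a"
  obtains T where "0 \<le> T" "\<And>R l t. orthogonal_matrix R \<Longrightarrow> norm l = 1 \<Longrightarrow> T \<le> t \<Longrightarrow> 0 < Qh \<rho> Q (geo R (t *\<^sub>R l))"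
proof -
  have "\<exists>n::nat. \<forall>R l t. orthogonal_matrix R \<and> norm l = 1 \<and> real n \<le> t \<longrightarrow> 0 < Qh \<rho> Q (geo R (t *\<^sub>R l))"
  proof (rule ccontr)
    assume "\<not> ?thesis"
    hence "\<forall>n::nat. \<exists>R l t. orthogonal_matrix R \<and> norm l = 1 \<and> real n \<le> t \<and> Qh \<rho> Q (geo R (t *\<^sub>R l)) \<le> 0"
      by (simp add: not_less)
    then obtain R where "\<forall>n::nat. \<exists>l t. orthogonal_matrix (R n) \<and> norm l = 1 \<and> real n \<le> t \<and>
        Qh \<rho> Q (geo (R n) (t *\<^sub>R l)) \<le> 0" by (rule choice[THEN exE])
    then obtain l where "\<forall>n::nat. \<exists>t. orthogonal_matrix (R n) \<and> norm (l n) = 1 \<and> real n \<le> t \<and>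
        Qh \<rho> Q (geo (R n) (t *\<^sub>R l n)) \<le> 0" by (rule choice[THEN exE])
    then obtain t where "\<forall>n::nat. orthogonal_matrix (R n) \<and> norm (l n) = 1 \<and> real n \<le> t n \<and>
        Qh \<rho> Q (geo (R n) (t n *\<^sub>R l n)) \<le> 0" by (rule choice[THEN exE])
    hence R: "\<And>n::nat. orthogonal_matrix (R n)" and l: "\<And>n. norm (l n) = 1"
      and t: "\<And>n. real n \<le> t n" and le: "\<And>n. Qh \<rho> Q (geo (R n) (t n *\<^sub>R l n)) \<le> 0" by simp_all
    let ?S = "{R :: real^'n^'n. orthogonal_matrix R} \<times> sphere (0::real^'n) 1"
    have comp: "compact ?S" by (intro compact_Times compact_orthogonal_matrices compact_sphere)
    have "\<forall>n. (R n, l n) \<in> ?S" using R l by auto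
    with comp[unfolded compact_def, THEN spec, of "\<lambda>n. (R n, l n)"]
    have "\<exists>p\<in>?S. \<exists>r. strict_mono r \<and> ((\<lambda>n. (R n, l n)) \<circ> r) \<longlonglongrightarrow> p" by (rule mp)
    then obtain p r where p: "p \<in> ?S" and r: "strict_mono r"
      and lim: "((\<lambda>n. (R n, l n)) \<circ> r) \<longlonglongrightarrow> p" by blast
    have orth: "orthogonal_matrix (fst p)" and nl: "norm (snd p) = 1" using p by auto
    have "Qh \<rho> Q (geo (fst p) (real k *\<^sub>R snd p)) \<le> 0" for k :: nat
    proof (rule tendsto_upperbound)
      have "\<forall>\<^sub>F n in sequentially. ((\<lambda>n. (R n, l n)) \<circ> r) n \<in> {R. orthogonal_matrix R} \<times> UNIV" using R by simp
      from continuous_on_tendsto_compose[OF continuous_on_Qh_geo lim _ this, of "real k"] orth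
      show "(\<lambda>n. Qh \<rho> Q (geo (R (r n)) (real k *\<^sub>R l (r n)))) \<longlonglongrightarrow> Qh \<rho> Q (geo (fst p) (real k *\<^sub>R snd p))"
        by (simp add: mem_Times_iff)
      have "Qh \<rho> Q (geo (R (r n)) (real k *\<^sub>R l (r n))) \<le> 0" if "k \<le> n" for n
      proof -
        have RR: "R (r n) ** transpose (R (r n)) = mat 1" using R by (simp add: orthogonal_matrix_def)
        have "real k \<le> t (r n)" using that seq_suble[OF r, of n] t[of "r n"] by linarith
        from Qh_sublevel_along_ray[OF orthogonal_matrix_invertible[OF R] _ this, of "r n" "l (r n)"]
        show ?thesis using le[of "r n"] by (simp add: RR Qh_identity)
      qed
      then show "\<forall>\<^sub>F n in sequentially. Qh \<rho> Q (geo (R (r n)) (real k *\<^sub>R l (r n))) \<le> 0"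
        by (rule eventually_sequentiallyI)
    qed simp
    moreover have "snd p \<noteq> 0" using nl by auto
    from Qh_exceeds_along_ray[OF U orthogonal_matrix_invertible[OF orth] this]
    obtain n where "0 < Qh \<rho> Q (geo (fst p) (real n *\<^sub>R snd p))"
      using orth by (auto simp: orthogonal_matrix_def Qh_identity)
    ultimately show False by (simp add: not_less[symmetric])
  qed
  then show thesis using that[of "real _"] by (metis of_nat_0_le_iff)
qed

lemma minimizer_exists:
  assumes U: "Q \<in> U_class a"
  obtains B where "B \<in> pd_mats" "\<And>A. A \<in> pd_mats \<Longrightarrow> Qh \<rho> Q B \<le> Qh \<rho> Q A"
proof -
  obtain T where T: "0 \<le> T" "\<And>R l t. orthogonal_matrix R \<Longrightarrow> norm l = 1 \<Longrightarrow> T \<le> t \<Longrightarrow> 0 < Qh \<rho> Q (geo R (t *\<^sub>R l))"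
    using Qh_coercive[OF U] by metis
  let ?K = "{R :: real^'n^'n. orthogonal_matrix R} \<times> cball (0::real^'n) T"
  have "compact ?K" by (intro compact_Times compact_orthogonal_matrices compact_cball)
  moreover have base: "(mat 1, 0) \<in> ?K" using T(1) by (simp add: orthogonal_matrix_id)
  hence "?K \<noteq> {}" by blast
  moreover have "continuous_on ?K (\<lambda>p. Qh \<rho> Q (geo (fst p) (1 *\<^sub>R snd p)))"
    by (rule continuous_on_subset[OF continuous_on_Qh_geo]) auto
  ultimately obtain p where p: "p \<in> ?K"
    and min: "\<And>p'. p' \<in> ?K \<Longrightarrow> Qh \<rho> Q (geo (fst p) (snd p)) \<le> Qh \<rho> Q (geo (fst p') (snd p'))"
    using continuous_attains_inf[of ?K "\<lambda>p. Qh \<rho> Q (geo (fst p) (1 *\<^sub>R snd p))"] by auto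
  define B where "B = geo (fst p) (snd p)"
  have "B \<in> pd_mats" unfolding B_def using p by (intro geo_in_pd_mats orthogonal_matrix_invertible) auto
  moreover have "Qh \<rho> Q B \<le> Qh \<rho> Q A" if A: "A \<in> pd_mats" for A
  proof -
    obtain R l where R: "orthogonal_matrix R" and Al: "A = geo R l" using pd_mats_geo_orthogonal[OF A] .
    show ?thesis
    proof (cases "norm l \<le> T")
      case True
      then show ?thesis using min[of "(R, l)"] R by (simp add: B_def Al)
    next
      case False
      have l0: "l \<noteq> 0" using False T(1) by auto
      have "0 < Qh \<rho> Q (geo R (norm l *\<^sub>R ((1 / norm l) *\<^sub>R l)))"
        using T(2)[OF R, of "(1 / norm l) *\<^sub>R l" "norm l"] False l0 by simp
      moreover have "Qh \<rho> Q B \<le> 0" using min[OF base] by (simp add: B_def geo_0 Qh_identity matrix_mul_lid)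
      ultimately show ?thesis using l0 by (simp add: Al)
    qed
  qed
  ultimately show thesis using that by blast
qed

end

theorem theorem3:
  fixes u \<rho> :: "real \<Rightarrow> real"
    and a\<^sub>0 :: real
    and Q :: "(real^'n) measure"
  assumes "\<And>s. s \<ge> 0 \<Longrightarrow> u s \<ge> 0"
    and "bounded (u ` {0..})"
    and "continuous_on {0..} u"
    and "bdd_above ((\<lambda>s. s * u s) ` {0..})"
    and "antimono_on {0..} u"
    and "strict_mono_on {0..} (\<lambda>s. s * u s)"
    and "\<And>s. s \<ge> 0 \<Longrightarrow> \<rho> s \<ge> 0"
    and "continuous_on {0..} \<rho>"
    and "\<And>s. s \<ge> 0 \<Longrightarrow> (\<rho> has_real_derivative u s / 2) (at s within {0..})"
    and "a\<^sub>0 = (SUP s\<in>{0<..}. s * u s)"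
    and "a\<^sub>0 > real CARD('n)"
    and "Q \<in> borel_prob_measures"
  shows "(Q \<notin> U_class a\<^sub>0 \<longrightarrow> critical_points (Qh \<rho> Q) = {}) \<and>
         (Q \<in> U_class a\<^sub>0 \<longrightarrow>
            (\<exists>B \<in> pd_mats. {A. is_arg_min (Qh \<rho> Q) (\<lambda>A. A \<in> pd_mats) A} = {B} \<and>
                           critical_points (Qh \<rho> Q) = {B}))"
proof -
  have bdd: "bdd_above ((\<lambda>s. s * u s) ` {0<..})"
    by (rule bdd_above_mono[OF assms(4)]) auto
  have smono: "s * u s < t * u t" if "0 \<le> s" "s < t" for s t
    using assms(6) that by (auto simp: strict_mono_on_def)
  have loss: "scatter_loss u \<rho> a\<^sub>0"
  proof
    show "u t \<le> u s" if "0 \<le> s" "s \<le> t" for s t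
      using assms(5) that by (auto simp: monotone_on_def)
    show "s * u s < a\<^sub>0" if "0 \<le> s" for s
    proof -
      have "s * u s < (s + 1) * u (s + 1)" using that by (intro smono) auto
      also have "\<dots> \<le> a\<^sub>0" unfolding assms(10) using that by (intro cSUP_upper bdd) auto
      finally show ?thesis .
    qed
    show "\<exists>s>0. b < s * u s" if "b < a\<^sub>0" for b
      using that less_cSUP_iff[OF _ bdd, of b] unfolding assms(10) by auto
  qed (use assms(1,3,7,8,9) smono in auto)
  interpret scatter_problem u \<rho> a\<^sub>0 Q
    using assms(12)
    by (intro scatter_problem.intro scatter_problem_axioms.intro loss) (auto simp: borel_prob_measures_def)
  have "\<exists>B \<in> pd_mats. {A. is_arg_min (Qh \<rho> Q) (\<lambda>A. A \<in> pd_mats) A} = {B} \<and> critical_points (Qh \<rho> Q) = {B}"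
    if U: "Q \<in> U_class a\<^sub>0"
  proof -
    obtain B where B: "B \<in> pd_mats" and min: "\<And>A. A \<in> pd_mats \<Longrightarrow> Qh \<rho> Q B \<le> Qh \<rho> Q A"
      using minimizer_exists[OF U] by blast
    have crit: "B \<in> critical_points (Qh \<rho> Q)"
      using critical_if_minimal[OF B min] B by (simp add: critical_points_def)
    note strict = critical_is_strict_minimum[OF U]
    have "A = B" if A: "A \<in> critical_points (Qh \<rho> Q)" for A
    proof (rule ccontr)
      assume "A \<noteq> B"
      hence "Qh \<rho> Q A < Qh \<rho> Q B" using strict[OF A B] by blast
      moreover have "Qh \<rho> Q B \<le> Qh \<rho> Q A" using A by (intro min) (simp add: critical_points_def)
      ultimately show False by simp
    qed
    hence "critical_points (Qh \<rho> Q) = {B}" using crit by blast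
    moreover have "{A. is_arg_min (Qh \<rho> Q) (\<lambda>A. A \<in> pd_mats) A} = {B}"
    proof -
      have "is_arg_min (Qh \<rho> Q) (\<lambda>A. A \<in> pd_mats) B"
        using B min by (auto simp: is_arg_min_def not_less)
      moreover have "A = B" if "is_arg_min (Qh \<rho> Q) (\<lambda>A. A \<in> pd_mats) A" for A
        using that strict[OF crit, of A] B unfolding is_arg_min_def by blast
      ultimately show ?thesis by blast
    qed
    ultimately show ?thesis using B by blast
  qed
  moreover have "critical_points (Qh \<rho> Q) = {}" if "Q \<notin> U_class a\<^sub>0"
    using U_class_if_critical that by blast
  ultimately show ?thesis by blast
qed

end
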